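(* Let $n$ be a positive integer. Every $\mathbf{X}\in\mathcal{P}_n$ has big Ramsey degree in $\mathcal{P}_n$ equal to $\tan^{(2|\mathbf{X}|-1)}(0)$; that is, $\tan^{(2|\mathbf{X}|-1)}(0)$ is the least natural number $L$ such that for every natural $k>0$, every map $\chi:\binom{\mathbb{Q}_n}{\mathbf{X}}\to\{0,\dots,k-1\}$ admits $\widetilde{\mathbf{Q}}\in\binom{\mathbb{Q}_n}{\mathbb{Q}_n}$ on which $\chi$ takes at most $L$ values on $\binom{\widetilde{\mathbf{Q}}}{\mathbf{X}}$.
   Context: $\mathcal{P}_n$ is the class of all finite structures $\mathbf{A}=(A,<^{\mathbf{A}},P_1^{\mathbf{A}},\dots,P_n^{\mathbf{A}})$ where $<^{\mathbf{A}}$ is a linear order on $A$ and $\{P_1^{\mathbf{A}},\dots,P_n^{\mathbf{A}}\}$ is a partition of $A$ into disjoint sets (some possibly empty); isomorphisms are order-preserving bijections $f$ with $x\in P_i^{\mathbf{A}}\iff f(x)\in P_i^{\mathbf{B}}$. $\mathbb{Q}_n=(\mathbb{Q},<,Q_1,\dots,Q_n)$ where $<$ is the usual order of the rationals and $Q_1,\dots,Q_n$ is a partition of $\mathbb{Q}$ into dense subsets (the unique countable homogeneous structure whose finite substructures form $\mathcal{P}_n$). For structures $\mathbf{X},\mathbf{Z}$ of this type, $\binom{\mathbf{Z}}{\mathbf{X}}$ is the set of substructures of $\mathbf{Z}$ isomorphic to $\mathbf{X}$. $\tan^{(m)}(0)$ is the $m$-th derivative of $\tan$ at $0$. *)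

theory Defs
  imports "HOL-Analysis.Analysis"
begin

text \<open>A finite structure X in P_n is given by a finite carrier A, a strict linear
order lt on A, and a colouring col : A -> {0..<n}; the partition classes are
P_(i+1) = {x \<in> A. col x = i}.\<close>

definition strict_linear_on :: "'a set \<Rightarrow> ('a \<Rightarrow> 'a \<Rightarrow> bool) \<Rightarrow> bool" where
  "strict_linear_on A lt \<longleftrightarrow>
     (\<forall>x\<in>A. \<not> lt x x) \<and>
     (\<forall>x\<in>A. \<forall>y\<in>A. \<forall>z\<in>A. lt x y \<longrightarrow> lt y z \<longrightarrow> lt x z) \<and>
     (\<forall>x\<in>A. \<forall>y\<in>A. x \<noteq> y \<longrightarrow> lt x y \<or> lt y x)"

definition in_P :: "nat \<Rightarrow> 'a set \<Rightarrow> ('a \<Rightarrow> 'a \<Rightarrow> bool) \<Rightarrow> ('a \<Rightarrow> nat) \<Rightarrow> bool" where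
  "in_P n A lt col \<longleftrightarrow> finite A \<and> strict_linear_on A lt \<and> (\<forall>x\<in>A. col x < n)"

text \<open>Q_n = (rat, <, Q_1..Q_n) is given by a colouring c of the rationals into
{0..<n} whose colour classes are all dense.\<close>

definition dense_colouring :: "nat \<Rightarrow> (rat \<Rightarrow> nat) \<Rightarrow> bool" where
  "dense_colouring n c \<longleftrightarrow>
     (\<forall>x. c x < n) \<and> (\<forall>a b. a < b \<longrightarrow> (\<forall>i<n. \<exists>x. a < x \<and> x < b \<and> c x = i))"

text \<open>binom(Q_n, X): substructures of Q_n isomorphic to X (identified with their
underlying sets, since substructures are induced).\<close>

definition copies :: "(rat \<Rightarrow> nat) \<Rightarrow> 'a set \<Rightarrow> ('a \<Rightarrow> 'a \<Rightarrow> bool) \<Rightarrow> ('a \<Rightarrow> nat) \<Rightarrow> rat set set" where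
  "copies c A lt col = {S. \<exists>f. bij_betw f A S \<and>
      (\<forall>x\<in>A. \<forall>y\<in>A. lt x y \<longleftrightarrow> f x < f y) \<and> (\<forall>x\<in>A. c (f x) = col x)}"

definition self_copies :: "(rat \<Rightarrow> nat) \<Rightarrow> rat set set" where
  "self_copies c = {Q. \<exists>f. bij_betw f UNIV Q \<and> strict_mono f \<and> (\<forall>x. c (f x) = c x)}"

definition big_ramsey_bound ::
  "(rat \<Rightarrow> nat) \<Rightarrow> 'a set \<Rightarrow> ('a \<Rightarrow> 'a \<Rightarrow> bool) \<Rightarrow> ('a \<Rightarrow> nat) \<Rightarrow> nat \<Rightarrow> bool" where
  "big_ramsey_bound c A lt col L \<longleftrightarrow>
     (\<forall>k::nat. k > 0 \<longrightarrow> (\<forall>(chi :: rat set \<Rightarrow> nat).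
        (\<forall>S\<in>copies c A lt col. chi S < k) \<longrightarrow>
        (\<exists>Q\<in>self_copies c. card (chi ` {S\<in>copies c A lt col. S \<subseteq> Q}) \<le> L)))"


definition least_elem :: "'b::order set \<Rightarrow> 'b \<Rightarrow> bool" where
  "least_elem S x \<longleftrightarrow> x \<in> S \<and> (\<forall>y\<in>S. x \<le> y)"

end

theory Submission
  imports Defs "HOL-Computational_Algebra.Polynomial"
begin

text \<open>The types of copies of a structure with \<open>m\<close> points are the alternating permutations of length
  \<open>2 * m - 1\<close>: fixing an enumeration of the rationals, \<open>x\<^sub>1 < \<dots> < x\<^sub>m\<close> has the type of the
  sequence \<open>r x\<^sub>1, \<delta>\<^sub>1, r x\<^sub>2, \<delta>\<^sub>2, \<dots>, r x\<^sub>m\<close>, where \<open>r\<close> is the position in the enumeration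
  and \<open>\<delta>\<^sub>i\<close> the least position of a separator of \<open>x\<^sub>i\<close> and \<open>x\<^sub>i\<^sub>+\<^sub>1\<close>.  Removing the minimum of an
  alternating sequence gives the recursion that \<open>tan' = 1 + tan\<^sup>2\<close> gives for the derivatives of the
  tangent.

  For the upper bound, code rationals by finite binary words, the \<open>p\<close>-th letter saying on which side
  of the \<open>p\<close>-th cut the rational lies.  A cut separates at most one pair of neighbours among
  \<open>x\<^sub>1, \<dots>, x\<^sub>m\<close>, so all \<open>m\<close> code words are substitution instances of a single parameter word with
  \<open>2 * m - 1\<close> parameters, in a way determined by the type.  The Carlson-Simpson theorem for parameter
  words then yields a copy on which the colour depends on the type alone.  That theorem is obtained
  from idempotent ultrafilters on words by a fusion argument.

  For the lower bound, every type is realised in every copy by choosing the entries of the sequence in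
  increasing order.\<close>

section \<open>Tangent numbers and alternating sequences\<close>

text \<open>The two bounds use different notions of type; only the number of types has to agree. The
  lower bound reads types from the enumeration itself, where the least separator of two points may
  be one of them, so some copies have repeated entries and no alternating type. The upper bound
  needs a type for every copy. It therefore gives each rational three positions: the cuts just
  before and just after it come before its level, and the level repeats the second cut, which keeps
  meets and levels disjoint.

  Colours never enter a type: the colours of a copy are dictated by \<open>X\<close>, and density
  supplies a point of any colour in any interval. This is why the degree does not depend on
  \<open>n\<close>.

  One copy has to serve all finite subsets at once, hence infinite parameter words. Although the
  code words are binary, alphabets of every size are needed: in the induction on the number of
  parameters, the entries of an initial word of length \<open>n\<close> act as \<open>n\<close>
  fixed letters.\<close>

definition tan_deriv_poly :: "real poly \<Rightarrow> real poly" where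
  "tan_deriv_poly p = [:1, 0, 1:] * pderiv p"

lemma tan_deriv_poly_add: "tan_deriv_poly (p + q) = tan_deriv_poly p + tan_deriv_poly q"
  by (simp only: tan_deriv_poly_def pderiv_add distrib_left)

lemma tan_deriv_poly_mult:
  "tan_deriv_poly (p * q) = tan_deriv_poly p * q + p * tan_deriv_poly q"
  by (simp only: tan_deriv_poly_def pderiv_mult distrib_left mult_ac add_ac)

lemma tan_deriv_poly_of_nat: "tan_deriv_poly (of_nat n) = 0"
  by (simp add: tan_deriv_poly_def pderiv_of_nat)

lemma tan_deriv_poly_sum: "tan_deriv_poly (sum f A) = (\<Sum>x\<in>A. tan_deriv_poly (f x))"
  by (induction A rule: infinite_finite_induct) (simp_all add: tan_deriv_poly_add, simp_all add: tan_deriv_poly_def)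

lemma tan_deriv_poly_Leibniz:
  "(tan_deriv_poly ^^ n) (p * q) =
     (\<Sum>k\<le>n. of_nat (n choose k) * ((tan_deriv_poly ^^ k) p * (tan_deriv_poly ^^ (n - k)) q))"
proof (induction n)
  case 0
  show ?case by simp
next
  case (Suc n)
  let ?D = "\<lambda>k. (tan_deriv_poly ^^ k)"
  have "?D (Suc n) (p * q) =
     (\<Sum>k\<le>n. of_nat (n choose k) * (?D (Suc k) p * ?D (n - k) q + ?D k p * ?D (Suc (n - k)) q))"
    by (simp add: Suc tan_deriv_poly_sum tan_deriv_poly_of_nat tan_deriv_poly_mult)
  also have "\<dots> = (\<Sum>k\<le>n. of_nat (n choose k) * (?D (Suc k) p * ?D (n - k) q)) +
     (\<Sum>k\<le>n. of_nat (n choose k) * (?D k p * ?D (Suc n - k) q))"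
    by (simp add: distrib_left sum.distrib Suc_diff_le)
  also have "(\<Sum>k\<le>n. of_nat (n choose k) * (?D k p * ?D (Suc n - k) q)) =
      ?D 0 p * ?D (Suc n) q + (\<Sum>k\<le>n. of_nat (n choose Suc k) * (?D (Suc k) p * ?D (n - k) q))"
  proof -
    have "(\<Sum>k\<le>n. of_nat (n choose k) * (?D k p * ?D (Suc n - k) q)) =
      (\<Sum>k\<le>Suc n. of_nat (n choose k) * (?D k p * ?D (Suc n - k) q))"
      by simp
    also have "\<dots> = ?D 0 p * ?D (Suc n) q + (\<Sum>k\<le>n. of_nat (n choose Suc k) * (?D (Suc k) p * ?D (n - k) q))"
      by (subst sum.atMost_Suc_shift) simp
    finally show ?thesis .
  qed
  also have "(\<Sum>k\<le>n. of_nat (n choose k) * (?D (Suc k) p * ?D (n - k) q)) +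
     (?D 0 p * ?D (Suc n) q + (\<Sum>k\<le>n. of_nat (n choose Suc k) * (?D (Suc k) p * ?D (n - k) q)))
     = (\<Sum>k\<le>Suc n. of_nat (Suc n choose k) * (?D k p * ?D (Suc n - k) q))"
    by (subst sum.atMost_Suc_shift) (simp add: sum.distrib distrib_right add_ac)
  finally show ?case .
qed

text \<open>By the chain rule and \<open>tan' = 1 + tan^2\<close>, differentiating a polynomial in
  the tangent is an algebraic operation on the polynomial; after this lemma no analysis remains. All
  \<open>x\<close> with \<open>cos x \<noteq> 0\<close> are covered because the next derivative
  needs the formula on a neighbourhood.\<close>

lemma deriv_iterate_tan:
  "cos x \<noteq> 0 \<Longrightarrow> (deriv ^^ n) (tan :: real \<Rightarrow> real) x = poly ((tan_deriv_poly ^^ n) [:0, 1:]) (tan x)"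
proof (induction n arbitrary: x)
  case 0
  then show ?case by simp
next
  case (Suc n)
  let ?p = "(tan_deriv_poly ^^ n) [:0, 1:]"
  have op: "open {x::real. cos x \<noteq> 0}"
    by (intro open_Collect_neq continuous_intros)
  have "((\<lambda>x. poly ?p (tan x)) has_real_derivative poly (pderiv ?p) (tan x) * inverse ((cos x)\<^sup>2)) (at x)"
    by (rule DERIV_chain2[OF poly_DERIV DERIV_tan[OF Suc.prems]])
  also have "inverse ((cos x)\<^sup>2) = 1 + (tan x)\<^sup>2"
    using tan_sec[OF Suc.prems] by (simp add: power_inverse)
  also have "poly (pderiv ?p) (tan x) * (1 + (tan x)\<^sup>2) = poly (tan_deriv_poly ?p) (tan x)"
    by (simp add: tan_deriv_poly_def algebra_simps power2_eq_square)
  finally have "((deriv ^^ n) tan has_real_derivative poly (tan_deriv_poly ?p) (tan x)) (at x)"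
    by (rule has_field_derivative_transform_within_open[OF _ op]) (use Suc in auto)
  then show ?case by (simp add: DERIV_imp_deriv)
qed

definition tangent :: "nat \<Rightarrow> real" where
  "tangent n = (deriv ^^ n) (tan :: real \<Rightarrow> real) 0"

lemma tangent_poly: "tangent n = poly ((tan_deriv_poly ^^ n) [:0, 1:]) 0"
  using deriv_iterate_tan[of 0 n] by (simp add: tangent_def)

lemma tangent_0: "tangent 0 = 0"
  by (simp add: tangent_poly)

lemma tangent_1: "tangent 1 = 1"
  by (simp add: tangent_poly tan_deriv_poly_def pderiv_pCons)

text \<open>One application turns \<open>X\<close> into \<open>1 + X * X\<close>. The other
  \<open>n\<close> applications kill the constant 1 exactly when \<open>n \<ge> 1\<close>, and the
  Leibniz rule expands the square. At \<open>n = 0\<close> the constant survives and gives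
  \<open>tangent 1 = 1\<close>.\<close>

lemma tangent_Suc:
  assumes "n \<ge> 1"
  shows "tangent (Suc n) = (\<Sum>k\<le>n. of_nat (n choose k) * (tangent k * tangent (n - k)))"
proof -
  let ?X = "[:0, 1:] :: real poly"
  have const: "(tan_deriv_poly ^^ n) 1 = 0" if "n \<ge> 1" for n
    using that
  proof (induction n rule: dec_induct)
    case base show ?case by (simp add: tan_deriv_poly_def pderiv_1)
  next
    case (step n) then show ?case by (simp add: tan_deriv_poly_def)
  qed
  have add: "(tan_deriv_poly ^^ n) (p + q) = (tan_deriv_poly ^^ n) p + (tan_deriv_poly ^^ n) q" for n p q
    by (induction n) (simp_all add: tan_deriv_poly_add)
  have "tan_deriv_poly ?X = 1 + ?X * ?X"
    by (simp add: tan_deriv_poly_def pderiv_pCons one_pCons)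
  then have "(tan_deriv_poly ^^ Suc n) ?X = (tan_deriv_poly ^^ n) (?X * ?X)"
    by (simp only: funpow_Suc_right add const[OF assms] o_apply add_0_left)
  also have "\<dots> = (\<Sum>k\<le>n. of_nat (n choose k) * ((tan_deriv_poly ^^ k) ?X * (tan_deriv_poly ^^ (n - k)) ?X))"
    by (rule tan_deriv_poly_Leibniz)
  finally show ?thesis
    by (simp add: tangent_poly poly_sum of_nat_poly)
qed

section \<open>Alternating sequences and their recursion\<close>

definition alternating :: "'a::linorder list \<Rightarrow> bool" where
  "alternating xs \<longleftrightarrow> odd (length xs) \<and>
     (\<forall>i. Suc i < length xs \<longrightarrow> (if even i then xs ! Suc i < xs ! i else xs ! i < xs ! Suc i))"

definition alternating_on :: "'a::linorder set \<Rightarrow> 'a list set" where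
  "alternating_on S = {xs. distinct xs \<and> set xs = S \<and> alternating xs}"

lemma finite_alternating_on: "finite S \<Longrightarrow> finite (alternating_on S)"
  by (rule finite_subset[OF _ finite_lists_length_eq[of S "card S"]])
    (auto simp: alternating_on_def distinct_card)

lemma alternating_append:
  assumes "alternating ys" "alternating zs" "\<forall>x \<in> set ys \<union> set zs. m < x"
  shows "alternating (ys @ m # zs)"
  unfolding alternating_def
proof (intro conjI allI impI)
  show "odd (length (ys @ m # zs))"
    using assms(1,2) by (simp add: alternating_def)
next
  fix i assume i: "Suc i < length (ys @ m # zs)"
  have odd: "odd (length ys)" using assms(1) by (simp add: alternating_def)
  consider "Suc i < length ys" | "Suc i = length ys" | "i = length ys" | j where "i = Suc (length ys) + j"
    by (metis Suc_lessI add_Suc less_iff_Suc_add linorder_neqE_nat not_less_eq)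
  then show "if even i then (ys @ m # zs) ! Suc i < (ys @ m # zs) ! i else (ys @ m # zs) ! i < (ys @ m # zs) ! Suc i"
  proof cases
    case 1 then show ?thesis using assms(1) by (simp add: alternating_def nth_append)
  next
    case 2
    then have "even i" using odd by (metis even_Suc)
    then show ?thesis using 2 assms(3) by (simp add: nth_append)
  next
    case 3
    then show ?thesis using odd assms(3) i by (simp add: nth_append)
  next
    case 4
    then show ?thesis using odd assms(2) i by (auto simp: nth_append alternating_def)
  qed
qed

text \<open>Even positions are peaks, so a minimum that has a neighbour sits at an odd position, and
  both sides have odd length. The one-element list is the exception: its entry is a peak and the
  minimum.\<close>

lemma alternating_appendD:
  assumes "alternating (ys @ m # zs)" "\<forall>x \<in> set ys \<union> set zs. m < x" "ys @ zs \<noteq> []"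
  shows "alternating ys \<and> alternating zs"
proof -
  let ?xs = "ys @ m # zs"
  have *: "if even i then ?xs ! Suc i < ?xs ! i else ?xs ! i < ?xs ! Suc i" if "Suc i < length ?xs" for i
    using assms(1) that by (auto simp: alternating_def)
  have odd: "odd (length ys)"
  proof (cases "ys = []")
    case True
    with assms(3) have "m < zs ! 0" "zs \<noteq> []" using assms(2) by auto
    with *[of 0] True show ?thesis by auto
  next
    case False
    then have "m < ys ! (length ys - 1)" using assms(2) by auto
    with *[of "length ys - 1"] False show ?thesis by (auto simp: nth_append split: if_splits)
  qed
  have "alternating ys"
    unfolding alternating_def
  proof (intro conjI allI impI odd)
    fix i assume "Suc i < length ys"
    with *[of i] show "if even i then ys ! Suc i < ys ! i else ys ! i < ys ! Suc i"
      by (auto simp: nth_append)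
  qed
  moreover have "alternating zs"
    unfolding alternating_def
  proof (intro conjI allI impI)
    show "odd (length zs)" using assms(1) odd by (auto simp: alternating_def)
    fix i assume "Suc i < length zs"
    with *[of "Suc (length ys) + i"] odd show "if even i then zs ! Suc i < zs ! i else zs ! i < zs ! Suc i"
      by (auto simp: nth_append)
  qed
  ultimately show ?thesis ..
qed

text \<open>\<open>T\<close> collects the entries left of the minimum. It may range over all
  subsets, since \<open>alternating_on\<close> is empty for sets of even size.\<close>

lemma alternating_on_Min_split:
  fixes S :: "'a::linorder set"
  assumes "finite S" "card S \<ge> 2"
  shows "bij_betw (\<lambda>(T, ys, zs). ys @ Min S # zs)
           (SIGMA T : Pow (S - {Min S}). alternating_on T \<times> alternating_on (S - {Min S} - T))
           (alternating_on S)"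
proof -
  let ?m = "Min S"
  have mS: "?m \<in> S" using assms by (intro Min_in) auto
  have gr: "?m < x" if "x \<in> S - {?m}" for x
    using Min_le[OF assms(1), of x] that by auto
  show ?thesis
  proof (rule bij_betw_imageI)
    show "inj_on (\<lambda>(T, ys, zs). ys @ Min S # zs)
           (SIGMA T : Pow (S - {Min S}). alternating_on T \<times> alternating_on (S - {Min S} - T))"
    proof (rule inj_onI, clarsimp)
      fix T ys zs T' ys' zs'
      assume a: "T \<subseteq> S - {?m}" "ys \<in> alternating_on T" "zs \<in> alternating_on (S - {?m} - T)"
        "T' \<subseteq> S - {?m}" "ys' \<in> alternating_on T'" "zs' \<in> alternating_on (S - {?m} - T')"
        "ys @ ?m # zs = ys' @ ?m # zs'"
      have n: "?m \<notin> set ys" "?m \<notin> set zs" "?m \<notin> set ys'" "?m \<notin> set zs'" using a by (auto simp: alternating_on_def)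
      then have "ys = ys' \<and> zs = zs'" using a(7)
        by (metis append_Cons_eq_iff)
      then show "T = T' \<and> ys = ys' \<and> zs = zs'" using a by (auto simp: alternating_on_def)
    qed
    show "(\<lambda>(T, ys, zs). ys @ Min S # zs) `
           (SIGMA T : Pow (S - {Min S}). alternating_on T \<times> alternating_on (S - {Min S} - T)) = alternating_on S"
    proof (intro equalityI subsetI)
      fix xs assume "xs \<in> (\<lambda>(T, ys, zs). ys @ Min S # zs) `
           (SIGMA T : Pow (S - {Min S}). alternating_on T \<times> alternating_on (S - {Min S} - T))"
      then obtain T ys zs where T: "T \<subseteq> S - {?m}" "ys \<in> alternating_on T" "zs \<in> alternating_on (S - {?m} - T)"
        and xs: "xs = ys @ ?m # zs" by auto
      have "alternating xs" unfolding xs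
        by (rule alternating_append) (use T gr in \<open>auto simp: alternating_on_def\<close>)
      then show "xs \<in> alternating_on S" using T mS by (auto simp: alternating_on_def xs)
    next
      fix xs assume xs: "xs \<in> alternating_on S"
      then obtain ys zs where e: "xs = ys @ ?m # zs"
        using mS by (metis (mono_tags, lifting) alternating_on_def mem_Collect_eq split_list)
      have d: "distinct xs" "set xs = S" "alternating xs" using xs by (auto simp: alternating_on_def)
      have "ys @ zs \<noteq> []"
        using d e assms(2) by (metis append_is_Nil_conv append.left_neutral card_1_singleton_iff distinct_card length_Cons list.size(3) One_nat_def numeral_2_eq_2 not_less_eq_eq le_refl)
      then have "alternating ys \<and> alternating zs"
        using d gr by (intro alternating_appendD) (auto simp: e)
      then have "(set ys, ys, zs) \<in> (SIGMA T : Pow (S - {Min S}). alternating_on T \<times> alternating_on (S - {Min S} - T))"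
        using d by (auto simp: alternating_on_def e)
      then show "xs \<in> (\<lambda>(T, ys, zs). ys @ Min S # zs) `
           (SIGMA T : Pow (S - {Min S}). alternating_on T \<times> alternating_on (S - {Min S} - T))"
        by (rule rev_image_eqI) (simp add: e)
    qed
  qed
qed

lemma sum_Pow_card:
  fixes g :: "nat \<Rightarrow> 'b::semiring_1"
  assumes "finite S"
  shows "(\<Sum>T\<in>Pow S. g (card T)) = (\<Sum>k\<le>card S. of_nat (card S choose k) * g k)"
proof -
  have "(\<Sum>T\<in>Pow S. g (card T)) = (\<Sum>k\<le>card S. \<Sum>T\<in>{T \<in> Pow S. card T = k}. g (card T))"
    by (rule sum.group[symmetric]) (use assms in \<open>auto intro: card_mono\<close>)
  also have "\<dots> = (\<Sum>k\<le>card S. of_nat (card S choose k) * g k)"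
    by (rule sum.cong) (use n_subsets[OF assms] in auto)
  finally show ?thesis .
qed

lemma card_alternating_on:
  fixes S :: "'a::linorder set"
  assumes "finite S"
  shows "real (card (alternating_on S)) = tangent (card S)"
  using assms
proof (induction "card S" arbitrary: S rule: less_induct)
  case less
  \<comment> \<open>The recursion \<open>tangent_Suc\<close> starts at index 1, so it reaches only
    sizes from 2 on. The empty list has even length and is not alternating, in accordance with
    \<open>tangent 0 = 0\<close>.\<close>
  consider "card S = 0" | "card S = 1" | "card S \<ge> 2" by linarith
  then show ?case
  proof cases
    case 1
    then have "alternating_on S = {}" using less.prems by (auto simp: alternating_on_def alternating_def)
    then show ?thesis using 1 by (simp add: tangent_0)
  next
    case 2
    then obtain x where x: "S = {x}" by (auto simp: card_1_singleton_iff)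
    have "xs = [x]" if "distinct xs" "set xs = {x}" for xs
      using that by (cases xs) (auto simp: subset_singleton_iff)
    then have "alternating_on S = {[x]}" by (auto simp: alternating_on_def alternating_def x)
    then show ?thesis using 2 tangent_1 by simp
  next
    case 3
    let ?S = "S - {Min S}"
    have mS: "Min S \<in> S" using 3 less.prems by (intro Min_in) auto
    have cS: "card S = Suc (card ?S)" using mS less.prems by (metis card.remove)
    have fS: "finite ?S" using less.prems by simp
    have IH: "real (card (alternating_on T)) = tangent (card T)" if "T \<subseteq> ?S" for T
      using that cS fS card_mono[OF fS that] by (intro less.hyps) (auto intro: finite_subset)
    have "card (alternating_on S) =
        card (SIGMA T : Pow ?S. alternating_on T \<times> alternating_on (?S - T))"
      using bij_betw_same_card[OF alternating_on_Min_split[OF less.prems 3]] by simp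
    also have "\<dots> = (\<Sum>T\<in>Pow ?S. card (alternating_on T) * card (alternating_on (?S - T)))"
      using fS by (subst card_SigmaI) (auto intro!: finite_alternating_on intro: finite_subset simp: card_cartesian_product)
    finally have "real (card (alternating_on S)) =
        (\<Sum>T\<in>Pow ?S. real (card (alternating_on T)) * real (card (alternating_on (?S - T))))"
      by simp
    also have "\<dots> = (\<Sum>T\<in>Pow ?S. tangent (card T) * tangent (card ?S - card T))"
    proof (rule sum.cong[OF refl])
      fix T assume "T \<in> Pow ?S"
      then have T: "T \<subseteq> ?S" by simp
      have "card (?S - T) = card ?S - card T" using T fS by (meson card_Diff_subset finite_subset)
      then show "real (card (alternating_on T)) * real (card (alternating_on (?S - T))) = tangent (card T) * tangent (card ?S - card T)"
        using IH[OF T] IH[of "?S - T"] by auto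
    qed
    also have "\<dots> = tangent (Suc (card ?S))"
      using sum_Pow_card[OF fS, of "\<lambda>k. tangent k * tangent (card ?S - k)"] tangent_Suc[of "card ?S"] 3 cS by simp
    finally show ?thesis using cS by simp
  qed
qed

section \<open>Ultrafilters on words\<close>

text \<open>Zorn's lemma for reverse inclusion, with compactness keeping the intersection of a chain
  non-empty. \<open>P\<close> will be the property of being a subsemigroup, and that of being a left
  ideal.\<close>

lemma compact_space_minimal_closed:
  assumes comp: "compact_space X" and K0: "closedin X K0" "K0 \<noteq> {}" "P K0"
    and Inter: "\<And>C. C \<noteq> {} \<Longrightarrow> (\<And>K. K \<in> C \<Longrightarrow> P K) \<Longrightarrow> P (\<Inter>C)"
  shows "\<exists>K. closedin X K \<and> K \<noteq> {} \<and> P K \<and> K \<subseteq> K0 \<and>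
    (\<forall>K'. closedin X K' \<longrightarrow> K' \<noteq> {} \<longrightarrow> P K' \<longrightarrow> K' \<subseteq> K \<longrightarrow> K' = K)"
proof -
  define F where "F = {K. closedin X K \<and> K \<noteq> {} \<and> P K \<and> K \<subseteq> K0}"
  have "\<exists>M\<in>F. \<forall>K\<in>F. K \<subseteq> M \<longrightarrow> K = M"
  proof (rule predicate_Zorn[where P = "\<lambda>x y. y \<subseteq> x"])
    show "partial_order_on F (relation_of (\<lambda>x y. y \<subseteq> x) F)"
      by (auto simp: partial_order_on_def preorder_on_def refl_on_def trans_def antisym_def relation_of_def)
  next
    fix C assume "C \<in> Chains (relation_of (\<lambda>x y. y \<subseteq> x) F)"
    then have chain: "\<And>A B. A \<in> C \<Longrightarrow> B \<in> C \<Longrightarrow> A \<in> F \<and> B \<in> F \<and> (A \<subseteq> B \<or> B \<subseteq> A)"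
      by (auto simp: Chains_def relation_of_def)
    show "\<exists>u\<in>F. \<forall>a\<in>C. u \<subseteq> a"
    proof (cases "C = {}")
      case True
      then show ?thesis using K0 by (auto simp: F_def)
    next
      case False
      have fin: "\<Inter>G \<in> C" if "finite G" "G \<noteq> {}" "G \<subseteq> C" for G
        using that
      proof (induction rule: finite_ne_induct)
        case (insert x G)
        then have "x \<in> C" "\<Inter>G \<in> C" by auto
        then have "x \<inter> \<Inter>G = x \<or> x \<inter> \<Inter>G = \<Inter>G" using chain by blast
        then show ?case using \<open>x \<in> C\<close> \<open>\<Inter>G \<in> C\<close> by auto
      qed auto
      have "\<Inter>G \<noteq> {}" if "finite G" "G \<subseteq> C" for G
        using fin[of G] that chain by (cases "G = {}") (auto simp: F_def)
      moreover have "\<forall>A\<in>C. closedin X A" using chain by (auto simp: F_def)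
      ultimately have "\<Inter>C \<noteq> {}" using comp[unfolded compact_space_fip, THEN spec[of _ C]] by simp
      moreover have "closedin X (\<Inter>C)" using False chain by (intro closedin_Inter) (auto simp: F_def)
      moreover have "P (\<Inter>C)" using False chain by (intro Inter) (auto simp: F_def)
      moreover have "A \<subseteq> K0" if "A \<in> C" for A using that chain by (auto simp: F_def)
      then have "\<Inter>C \<subseteq> K0" using False by blast
      ultimately have "\<Inter>C \<in> F" by (simp add: F_def)
      then show ?thesis by blast
    qed
  qed
  then obtain M where "M \<in> F" and "\<And>K. K \<in> F \<Longrightarrow> K \<subseteq> M \<Longrightarrow> K = M" by blast
  then show ?thesis unfolding F_def by (intro exI[of _ M]) auto
qed

text \<open>Let \<open>T\<close> be a minimal closed subsemigroup and \<open>e\<close> in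
  \<open>T\<close>. Then \<open>T e\<close> is again a closed subsemigroup, hence all of
  \<open>T\<close>, so \<open>t e = e\<close> has a solution. The solutions form a closed
  subsemigroup too, hence all of \<open>T\<close>, and \<open>e\<close> is one of them.\<close>

lemma Ellis_idempotent:
  assumes comp: "compact_space X" and haus: "Hausdorff_space X"
    and R: "closedin X R" "R \<noteq> {}"
    and closed: "\<And>p q. p \<in> R \<Longrightarrow> q \<in> R \<Longrightarrow> m p q \<in> R"
    and assoc: "\<And>p q r. m (m p q) r = m p (m q r)"
    and cont: "\<And>q. q \<in> R \<Longrightarrow> continuous_map X X (\<lambda>p. m p q)"
  shows "\<exists>e\<in>R. m e e = e"
proof -
  let ?P = "\<lambda>K. \<forall>p\<in>K. \<forall>q\<in>K. m p q \<in> K"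
  have "\<exists>T. closedin X T \<and> T \<noteq> {} \<and> ?P T \<and> T \<subseteq> R \<and>
    (\<forall>K. closedin X K \<longrightarrow> K \<noteq> {} \<longrightarrow> ?P K \<longrightarrow> K \<subseteq> T \<longrightarrow> K = T)"
    by (rule compact_space_minimal_closed[OF comp R]) (simp add: closed, blast)
  then obtain T where T: "closedin X T" "T \<noteq> {}" "?P T" "T \<subseteq> R"
    and min: "\<And>K. closedin X K \<Longrightarrow> K \<noteq> {} \<Longrightarrow> ?P K \<Longrightarrow> K \<subseteq> T \<Longrightarrow> K = T"
    by (elim exE conjE) simp
  obtain e where e: "e \<in> T" using T by blast
  have ce: "continuous_map X X (\<lambda>p. m p e)" using cont e T by blast
  have "(\<lambda>p. m p e) ` T = T"
  proof (rule min)
    have "compactin X T" using comp T(1) by (rule closedin_compact_space)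
    then show "closedin X ((\<lambda>p. m p e) ` T)"
      using ce haus by (intro compactin_imp_closedin image_compactin)
    show "\<forall>p\<in>(\<lambda>p. m p e) ` T. \<forall>q\<in>(\<lambda>p. m p e) ` T. m p q \<in> (\<lambda>p. m p e) ` T"
    proof (clarify)
      fix p q assume "p \<in> T" "q \<in> T"
      then have "m (m p e) (m q e) = m (m (m p e) q) e" "m (m p e) q \<in> T"
        using T(3) e assoc by auto
      then show "m (m p e) (m q e) \<in> (\<lambda>p. m p e) ` T" by blast
    qed
  qed (use T e in auto)
  then have "e \<in> (\<lambda>p. m p e) ` T" using e by (simp only:)
  then obtain t where "t \<in> T" "e = m t e" by (rule imageE)
  note t = this(1) this(2)[symmetric]
  have "{t \<in> T. m t e = e} = T"
  proof (rule min)
    have "closedin X {x \<in> topspace X. m x e \<in> {e}}"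
    proof (rule closedin_continuous_map_preimage[OF ce])
      show "closedin X {e}"
        using closedin_Hausdorff_singleton[OF haus] closedin_subset[OF T(1)] e by auto
    qed
    then have "closedin X (T \<inter> {x \<in> topspace X. m x e \<in> {e}})" using T(1) by (rule closedin_Int[rotated])
    also have "T \<inter> {x \<in> topspace X. m x e \<in> {e}} = {t \<in> T. m t e = e}"
      using closedin_subset[OF T(1)] by auto
    finally show "closedin X {t \<in> T. m t e = e}" .
    show "\<forall>p\<in>{t \<in> T. m t e = e}. \<forall>q\<in>{t \<in> T. m t e = e}. m p q \<in> {t \<in> T. m t e = e}"
      using T(3) assoc by auto
  qed (use t in auto)
  then have "e \<in> {t \<in> T. m t e = e}" using e by (simp only:)
  then have "m e e = e" by (simp only: mem_Collect_eq)
  then show ?thesis using e T(4) by blast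
qed

text \<open>Ultrafilters on the monoid of words are predicates on sets of words, so that the
  Stone-Cech compactification is a closed subspace of a power of the two-point space.\<close>

definition ultra :: "('a set \<Rightarrow> bool) \<Rightarrow> bool" where
  "ultra p \<longleftrightarrow> (\<forall>A B. p (A \<inter> B) \<longleftrightarrow> p A \<and> p B) \<and> (\<forall>A. p (- A) \<longleftrightarrow> \<not> p A)"

text \<open>The extension of concatenation to ultrafilters: for \<open>p\<close>-many
  \<open>s\<close>, for \<open>q\<close>-many \<open>t\<close>, the word \<open>s @ t\<close> lies
  in \<open>A\<close>. With the quantifiers in this order, the product is continuous in its left
  argument.\<close>

definition umult :: "('a list set \<Rightarrow> bool) \<Rightarrow> ('a list set \<Rightarrow> bool) \<Rightarrow> 'a list set \<Rightarrow> bool" where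
  "umult p q = (\<lambda>A. p {s. q {t. s @ t \<in> A}})"

definition umap :: "('a \<Rightarrow> 'b) \<Rightarrow> ('a set \<Rightarrow> bool) \<Rightarrow> 'b set \<Rightarrow> bool" where
  "umap f p = (\<lambda>A. p (f -` A))"

definition uprincipal :: "'a \<Rightarrow> 'a set \<Rightarrow> bool" where
  "uprincipal x = (\<lambda>A. x \<in> A)"

abbreviation utop :: "('a set \<Rightarrow> bool) topology" where
  "utop \<equiv> product_topology (\<lambda>_. discrete_topology UNIV) UNIV"

lemma topspace_utop [simp]: "topspace utop = UNIV"
  by (simp add: PiE_UNIV_domain)

lemma compact_space_utop: "compact_space utop"
  by (simp add: compact_space_product_topology compact_space_discrete_topology)

lemma Hausdorff_space_utop: "Hausdorff_space utop"
  by (simp add: Hausdorff_space_product_topology)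

lemma continuous_map_utop_coord: "continuous_map utop (discrete_topology UNIV) (\<lambda>p. p A)"
  by (rule continuous_map_product_projection) simp

lemma continuous_map_utop_reindex: "continuous_map utop utop (\<lambda>p A. p (h A))"
  by (simp add: continuous_map_componentwise_UNIV continuous_map_utop_coord)

lemma closedin_utop_coord: "closedin utop {p. p A}" "closedin utop {p. \<not> p A}"
  using closedin_continuous_map_preimage[OF continuous_map_utop_coord, of "{True}" A]
    closedin_continuous_map_preimage[OF continuous_map_utop_coord, of "{False}" A] by auto

text \<open>Each instance of the two axioms restricts finitely many coordinates, so it defines a
  clopen set.\<close>

lemma closedin_ultra: "closedin utop {p. ultra p}"
proof -
  have imp: "closedin utop {p :: 'a set \<Rightarrow> bool. p A \<longleftrightarrow> \<not> p B}" for A B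
  proof -
    have "{p :: 'a set \<Rightarrow> bool. p A \<longleftrightarrow> \<not> p B} = ({p. p A} \<inter> {p. \<not> p B}) \<union> ({p. \<not> p A} \<inter> {p. p B})"
      by auto
    then show ?thesis by (simp add: closedin_utop_coord closedin_Int closedin_Un)
  qed
  have conj: "closedin utop {p :: 'a set \<Rightarrow> bool. p C \<longleftrightarrow> p A \<and> p B}" for A B C
  proof -
    have "{p :: 'a set \<Rightarrow> bool. p C \<longleftrightarrow> p A \<and> p B} =
        ({p. p C} \<inter> {p. p A} \<inter> {p. p B}) \<union> ({p. \<not> p C} \<inter> ({p. \<not> p A} \<union> {p. \<not> p B}))"
      by auto
    then show ?thesis by (simp add: closedin_utop_coord closedin_Int closedin_Un)
  qed
  have "{p :: 'a set \<Rightarrow> bool. ultra p} =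
      (\<Inter>A. \<Inter>B. {p. p (A \<inter> B) \<longleftrightarrow> p A \<and> p B}) \<inter> (\<Inter>A. {p. p (- A) \<longleftrightarrow> \<not> p A})"
    by (auto simp: ultra_def)
  also have "closedin utop \<dots>"
    by (intro closedin_Int closedin_INT) (use imp conj in auto)
  finally show ?thesis .
qed

lemma ultra_Int: "ultra p \<Longrightarrow> p (A \<inter> B) \<longleftrightarrow> p A \<and> p B"
  by (simp add: ultra_def)

lemma ultra_mono: "ultra p \<Longrightarrow> p A \<Longrightarrow> A \<subseteq> B \<Longrightarrow> p B"
  by (metis inf.absorb_iff1 ultra_def)

lemma ultra_empty: "ultra p \<Longrightarrow> \<not> p {}"
  by (metis ultra_def inf_compl_bot)

lemma ultra_UNIV: "ultra p \<Longrightarrow> p UNIV"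
  by (metis ultra_def ultra_empty Compl_empty_eq)

lemma ultra_nonempty: "ultra p \<Longrightarrow> p A \<Longrightarrow> \<exists>x. x \<in> A"
  by (metis ultra_empty ex_in_conv)

lemma ultra_finite_INT:
  assumes "ultra p" "finite I" "\<And>i. i \<in> I \<Longrightarrow> p (A i)"
  shows "p (\<Inter>i\<in>I. A i)"
  using assms(2,3) by (induction) (auto simp: ultra_UNIV ultra_Int assms(1))

lemma ultra_cong: "ultra p \<Longrightarrow> p C \<Longrightarrow> A \<inter> C = B \<inter> C \<Longrightarrow> p A \<longleftrightarrow> p B"
  by (metis ultra_def)

lemma ultra_finite_UN:
  assumes "ultra p" "finite I" "p (\<Union>i\<in>I. A i)"
  shows "\<exists>i\<in>I. p (A i)"
proof (rule ccontr)
  assume "\<not> ?thesis"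
  then have "p (\<Inter>i\<in>I. - A i)"
    using assms(1) by (intro ultra_finite_INT[OF assms(1,2)]) (simp add: ultra_def)
  then have "p ((\<Inter>i\<in>I. - A i) \<inter> (\<Union>i\<in>I. A i))"
    using assms(3) by (simp only: ultra_Int[OF assms(1)])
  moreover have "(\<Inter>i\<in>I. - A i) \<inter> (\<Union>i\<in>I. A i) = {}" by auto
  ultimately show False using ultra_empty[OF assms(1)] by (simp only:)
qed

lemma ultra_umult: "ultra p \<Longrightarrow> ultra q \<Longrightarrow> ultra (umult p q)"
  unfolding ultra_def umult_def
  by (simp add: Collect_conj_eq Collect_neg_eq)

lemma ultra_uprincipal: "ultra (uprincipal x)"
  by (auto simp: ultra_def uprincipal_def)

lemma umult_assoc: "umult (umult p q) r = umult p (umult q r)"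
  by (simp add: umult_def fun_eq_iff)

lemma umap_umult: "umap (map f) (umult p q) = umult (umap (map f) p) (umap (map f) q)"
  by (simp add: umult_def umap_def vimage_def fun_eq_iff)

lemma continuous_map_umult: "continuous_map utop utop (\<lambda>p. umult p q)"
  unfolding umult_def by (rule continuous_map_utop_reindex)

lemma continuous_map_umap: "continuous_map utop utop (umap f)"
  unfolding umap_def by (rule continuous_map_utop_reindex)

text \<open>\<open>M e\<close> is a closed left ideal inside \<open>M\<close>, so it equals
  \<open>M\<close>. Thus \<open>p = r e\<close> for some \<open>r\<close>, and
  \<open>p e = r e e = r e = p\<close>.\<close>

lemma minimal_left_ideal_idempotent:
  assumes M: "closedin utop M" "M \<noteq> {}" "\<And>p q. p \<in> U \<Longrightarrow> q \<in> M \<Longrightarrow> umult p q \<in> M" "M \<subseteq> U"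
    and min: "\<And>K. closedin utop K \<Longrightarrow> K \<noteq> {} \<Longrightarrow> (\<And>p q. p \<in> U \<Longrightarrow> q \<in> K \<Longrightarrow> umult p q \<in> K) \<Longrightarrow>
      K \<subseteq> M \<Longrightarrow> K = M"
    and e: "e \<in> M" "umult e e = e" and p: "p \<in> M"
  shows "umult p e = p"
proof -
  have "(\<lambda>p. umult p e) ` M = M"
  proof (rule min)
    show "closedin utop ((\<lambda>p. umult p e) ` M)"
      by (intro compactin_imp_closedin image_compactin[OF _ continuous_map_umult] Hausdorff_space_utop
          closedin_compact_space[OF compact_space_utop M(1)])
    fix p q assume "p \<in> U" "q \<in> (\<lambda>p. umult p e) ` M"
    then show "umult p q \<in> (\<lambda>p. umult p e) ` M"
      using M(3) by (auto simp: umult_assoc[symmetric])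
  qed (use M e in auto)
  then obtain r where "r \<in> M" "p = umult r e" using p by blast
  then show ?thesis using e by (simp add: umult_assoc)
qed

section \<open>Ultrafilters on words with a variable\<close>

definition subst_var :: "nat \<Rightarrow> nat \<Rightarrow> nat list \<Rightarrow> nat list" where
  "subst_var a c = map (\<lambda>y. if y = a then c else y)"

text \<open>Words over the alphabet \<open>{..<a}\<close>; the letter \<open>a\<close> itself is the variable.  Since the words
  beginning with the variable form a right ideal, \<open>q\<close> is obtained as an idempotent of the closed
  semigroup of all ultrafilters on them whose \<open>a\<close> substitution instances lie in one fixed minimal
  left ideal \<open>M\<close>; idempotents of \<open>M\<close> are right identities of \<open>M\<close>.\<close>

lemma left_variable_ultrafilter:
  assumes a: "a \<ge> 1"
  obtains p q where "ultra p" "ultra q" "p (lists {..<a})" "q {v. \<exists>u. v = a # u \<and> set u \<subseteq> {..a}}"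
    "\<And>c. c < a \<Longrightarrow> umult p (umap (subst_var a c) q) = p"
    "\<And>c d. c < a \<Longrightarrow> d < a \<Longrightarrow>
       umult (umap (subst_var a c) q) (umap (subst_var a d) q) = umap (subst_var a c) q"
proof -
  define U where "U = {p. ultra p \<and> p (lists {..<a})}"
  define V where "V = {v. \<exists>u. v = a # u \<and> set u \<subseteq> {..a}}"
  define R0 where "R0 = {r. ultra r \<and> r V}"
  have clU: "closedin utop U"
    using closedin_Int[OF closedin_ultra closedin_utop_coord(1)] by (simp add: U_def Int_def)
  have clR0: "closedin utop R0"
    using closedin_Int[OF closedin_ultra closedin_utop_coord(1)] by (simp add: R0_def Int_def)
  have "uprincipal [] \<in> U" by (simp add: U_def ultra_uprincipal) (simp add: uprincipal_def)
  then have neU: "U \<noteq> {}" by blast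
  have multU: "umult p q \<in> U" if "p \<in> U" "q \<in> U" for p q
  proof -
    have "p {s. q {t. s @ t \<in> lists {..<a}}}"
    proof (rule ultra_mono)
      show "lists {..<a} \<subseteq> {s. q {t. s @ t \<in> lists {..<a}}}"
        using that by (auto simp: U_def intro: ultra_mono)
    qed (use that in \<open>auto simp: U_def\<close>)
    then show ?thesis using that by (auto simp: U_def ultra_umult) (simp add: umult_def)
  qed
  let ?P = "\<lambda>K. \<forall>p\<in>U. \<forall>q\<in>K. umult p q \<in> K"
  have "\<exists>M. closedin utop M \<and> M \<noteq> {} \<and> ?P M \<and> M \<subseteq> U \<and>
    (\<forall>K. closedin utop K \<longrightarrow> K \<noteq> {} \<longrightarrow> ?P K \<longrightarrow> K \<subseteq> M \<longrightarrow> K = M)"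
    by (rule compact_space_minimal_closed[OF compact_space_utop clU neU]) (simp add: multU, blast)
  then obtain M where M: "closedin utop M" "M \<noteq> {}" "?P M" "M \<subseteq> U"
    and min: "\<And>K. closedin utop K \<Longrightarrow> K \<noteq> {} \<Longrightarrow> ?P K \<Longrightarrow> K \<subseteq> M \<Longrightarrow> K = M"
    by (elim exE conjE) simp
  have right_id: "umult p e = p" if "e \<in> M" "umult e e = e" "p \<in> M" for p e
    by (rule minimal_left_ideal_idempotent[of M U]) (use M min that in auto)
  define R where "R = {r \<in> R0. \<forall>c<a. umap (subst_var a c) r \<in> M}"
  have clR: "closedin utop R"
  proof -
    have "closedin utop {r. umap (subst_var a c) r \<in> M}" for c
      using closedin_continuous_map_preimage[OF continuous_map_umap[of "subst_var a c"] M(1)] by simp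
    then have "closedin utop (R0 \<inter> (\<Inter>c\<in>{..<a}. {r. umap (subst_var a c) r \<in> M}))"
      using a clR0 by (intro closedin_Int closedin_INT) (auto simp: lessThan_empty_iff)
    also have "\<dots> = R" by (auto simp: R_def)
    finally show ?thesis .
  qed
  have subst_umult: "umap (subst_var a c) (umult p q) = umult (umap (subst_var a c) p) (umap (subst_var a c) q)" for c p q
    by (simp add: subst_var_def umap_umult)
  have multR: "umult p q \<in> R" if "p \<in> R" "q \<in> R" for p q
  proof -
    have "p {s. q {t. s @ t \<in> V}}"
    proof (rule ultra_mono)
      show "V \<subseteq> {s. q {t. s @ t \<in> V}}"
      proof
        fix s assume s: "s \<in> V"
        have "q {t. s @ t \<in> V}"
        proof (rule ultra_mono)
          show "q V" "ultra q" using that by (auto simp: R_def R0_def)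
          show "V \<subseteq> {t. s @ t \<in> V}" using s by (auto simp: V_def)
        qed
        then show "s \<in> {s. q {t. s @ t \<in> V}}" by simp
      qed
    qed (use that in \<open>auto simp: R_def R0_def\<close>)
    then have "umult p q \<in> R0" using that by (auto simp: R_def R0_def ultra_umult) (simp add: umult_def)
    then show ?thesis using that M by (auto simp: R_def subst_umult)
  qed
  obtain p where p: "p \<in> M" using M by blast
  have pU: "ultra p" "p (lists {..<a})" using p M by (auto simp: U_def)
  \<comment> \<open>The witness for non-emptiness is the variable followed by \<open>p\<close>.
    Substituting \<open>c\<close> leaves \<open>p\<close> alone, as \<open>p\<close> lives on words
    without the variable, and gives the product of \<open>[c]\<close> and \<open>p\<close>, which
    lies in the left ideal \<open>M\<close>.\<close>
  have "umult (uprincipal [a]) p \<in> R"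
  proof -
    have "p {t. [a] @ t \<in> V}"
    proof (rule ultra_mono[OF pU])
      have "{..<a} \<subseteq> {..a}" by auto
      then show "lists {..<a} \<subseteq> {t. [a] @ t \<in> V}" unfolding V_def lists_eq_set by auto
    qed
    then have "umult (uprincipal [a]) p \<in> R0"
      using pU by (simp add: R0_def ultra_umult ultra_uprincipal) (simp add: umult_def uprincipal_def)
    moreover have "umap (subst_var a c) (umult (uprincipal [a]) p) \<in> M" if "c < a" for c
    proof -
      have "umap (subst_var a c) p = p"
      proof
        fix A
        have "subst_var a c s = s" if "\<forall>y\<in>set s. y < a" for s
          using that by (auto simp: subst_var_def intro!: map_idI)
        then show "umap (subst_var a c) p A = p A"
          unfolding umap_def by (intro ultra_cong[OF pU]) auto
      qed
      moreover have "umap (subst_var a c) (uprincipal [a]) = uprincipal [c]"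
        by (simp add: umap_def uprincipal_def subst_var_def)
      moreover have "uprincipal [c] \<in> U"
        using that by (simp add: U_def ultra_uprincipal) (simp add: uprincipal_def)
      ultimately show ?thesis using M p by (simp add: subst_umult)
    qed
    ultimately show ?thesis by (simp add: R_def)
  qed
  then have neR: "R \<noteq> {}" by blast
  have "\<exists>q\<in>R. umult q q = q"
    by (rule Ellis_idempotent[OF compact_space_utop Hausdorff_space_utop clR neR
          multR umult_assoc continuous_map_umult])
  then obtain q where q: "q \<in> R" "umult q q = q" by blast
  have qM: "umap (subst_var a c) q \<in> M" if "c < a" for c
    using q that by (auto simp: R_def)
  have qi: "umult (umap (subst_var a c) q) (umap (subst_var a c) q) = umap (subst_var a c) q" for c
    using q(2) subst_umult by metis
  show thesis
  proof (rule that[OF pU(1) _ pU(2)])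
    show "ultra q" "q {v. \<exists>u. v = a # u \<and> set u \<subseteq> {..a}}" using q(1) by (simp_all add: R_def R0_def V_def)
    show "umult p (umap (subst_var a c) q) = p" if "c < a" for c
      by (rule right_id[OF qM[OF that] qi p])
    show "umult (umap (subst_var a c) q) (umap (subst_var a d) q) = umap (subst_var a c) q"
      if "c < a" "d < a" for c d
      by (rule right_id[OF qM[OF that(2)] qi qM[OF that(1)]])
  qed
qed

section \<open>Parameter words\<close>

text \<open>An infinite parameter word over the alphabet \<open>{..<a}\<close> is coded as a rigid surjection of
  \<open>nat\<close> that is the identity on \<open>{..<a}\<close>: values \<open>< a\<close> are letters, the others are parameters.
  Substituting parameter words then becomes composition of functions.\<close>

definition rigid :: "nat \<Rightarrow> (nat \<Rightarrow> nat) \<Rightarrow> bool" where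
  "rigid a W \<longleftrightarrow> (\<forall>i<a. W i = i) \<and> surj W \<and> (\<forall>p. \<forall>j<W p. \<exists>i<p. W i = j)"

definition first :: "(nat \<Rightarrow> nat) \<Rightarrow> nat \<Rightarrow> nat" where
  "first W n = (LEAST p. W p = n)"

text \<open>Substitution of the finite word \<open>V\<close> into the infinite parameter word
  \<open>W\<close>. The result stops at the first parameter to which \<open>V\<close> assigns no
  letter. By \<open>act_comp\<close> this is a right action of the monoid of rigid
  surjections.\<close>

definition act :: "'a list \<Rightarrow> (nat \<Rightarrow> nat) \<Rightarrow> 'a list" where
  "act V W = map (\<lambda>p. V ! W p) [0..<first W (length V)]"

text \<open>Finite parameter words over \<open>{..<a}\<close> with \<open>b - a\<close> parameters,
  all of which occur, with first occurrences in increasing order. As for \<open>rigid\<close>, the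
  word starts with a copy of the alphabet.\<close>

definition words :: "nat \<Rightarrow> nat \<Rightarrow> nat list set" where
  "words a b = {V. a \<le> length V \<and> (\<forall>i<a. V ! i = i) \<and> set V = {..<b} \<and>
     (\<forall>p<length V. \<forall>j<V ! p. \<exists>i<p. V ! i = j)}"

lemma rigid_fix: "rigid a W \<Longrightarrow> i < a \<Longrightarrow> W i = i"
  unfolding rigid_def by simp

lemma rigid_surj: "rigid a W \<Longrightarrow> surj W"
  unfolding rigid_def by simp

lemma rigid_prev: "rigid a W \<Longrightarrow> j < W p \<Longrightarrow> \<exists>i<p. W i = j"
  unfolding rigid_def by simp

lemma rigid_mono: "rigid a W \<Longrightarrow> b \<le> a \<Longrightarrow> rigid b W"
  by (auto simp: rigid_def)

lemma rigid_id: "rigid a id"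
  by (auto simp: rigid_def)

lemma rigid_comp:
  assumes "rigid a R" "rigid a W"
  shows "rigid a (R \<circ> W)"
  unfolding rigid_def
proof (intro conjI allI impI)
  show "surj (R \<circ> W)" using assms by (intro comp_surj rigid_surj)
  fix p j assume "j < (R \<circ> W) p"
  then obtain i where i: "i < W p" "R i = j" using rigid_prev[OF assms(1)] by force
  then obtain i' where "i' < p" "W i' = i" using rigid_prev[OF assms(2)] by blast
  then show "\<exists>i<p. (R \<circ> W) i = j" using i by auto
qed (use assms in \<open>simp add: rigid_fix\<close>)

lemma rigid_le:
  assumes "rigid a W"
  shows "W p \<le> p"
proof (induction p rule: less_induct)
  case (less p)
  show ?case
  proof (cases "W p")
    case (Suc v)
    then obtain i where "i < p" "W i = v" using rigid_prev[OF assms, of v p] by auto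
    then show ?thesis using less[of i] Suc by simp
  qed simp
qed

lemma first_le: "W p = n \<Longrightarrow> first W n \<le> p"
  unfolding first_def by (rule Least_le)

context
  fixes a W assumes W: "rigid a W"
begin

lemma rigid_first: "W (first W n) = n"
proof -
  obtain p where "n = W p" using rigid_surj[OF W] by (rule surjE)
  then have "W p = n" by (rule sym)
  then show ?thesis unfolding first_def by (rule LeastI[of "\<lambda>p. W p = n"])
qed

lemma rigid_less_first: "p < first W n \<Longrightarrow> W p < n"
proof (rule ccontr)
  assume p: "p < first W n" "\<not> W p < n"
  have "W p \<noteq> n" using p(1) first_le[of W p n] by auto
  then have "n < W p" using p(2) by simp
  then obtain i where "i < p" "W i = n" using rigid_prev[OF W] by blast
  then show False using p(1) first_le[of W i n] by simp
qed

lemma rigid_le_first: "n \<le> first W n"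
  using rigid_le[OF W, of "first W n"] by (simp add: rigid_first)

lemma rigid_first_mono: "m < n \<Longrightarrow> first W m < first W n"
proof -
  assume "m < n"
  then have "m < W (first W n)" by (simp add: rigid_first)
  then obtain i where "i < first W n" "W i = m" using rigid_prev[OF W] by blast
  then show "first W m < first W n" using first_le[of W i m] by simp
qed

lemma rigid_first_id: "i < a \<Longrightarrow> first W i = i"
  using rigid_le_first[of i] first_le[of W i i] rigid_fix[OF W, of i] by simp

lemma length_act: "length (act V W) = first W (length V)"
  by (simp add: act_def)

lemma nth_act: "p < first W (length V) \<Longrightarrow> act V W ! p = V ! W p"
  by (simp add: act_def)

lemma set_act: "set (act V W) = set V"
proof -
  have "W ` {0..<first W (length V)} = {..<length V}"
  proof (intro equalityI subsetI)
    fix j assume "j \<in> {..<length V}"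
    then have "W (first W j) = j" "first W j < first W (length V)"
      by (auto simp: rigid_first intro: rigid_first_mono)
    then show "j \<in> W ` {0..<first W (length V)}" by (metis atLeastLessThan_iff image_eqI zero_le)
  qed (auto simp: rigid_less_first)
  moreover have "set V = (!) V ` {..<length V}" by (auto simp: set_conv_nth)
  moreover have "set (act V W) = (!) V ` W ` {0..<first W (length V)}" by (simp add: act_def image_image)
  ultimately show ?thesis by (simp only:)
qed

lemma map_act: "map f (act V W) = act (map f V) W"
  by (auto simp: act_def rigid_less_first)

lemma act_comp: 
  assumes R: "rigid b R"
  shows "act V (R \<circ> W) = act (act V R) W"
proof -
  let ?n = "length V"
  have "first (R \<circ> W) ?n = first W (first R ?n)"
    unfolding first_def[of "R \<circ> W"]
  proof (rule Least_equality)
    show "(R \<circ> W) (first W (first R ?n)) = ?n"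
      using Submission.rigid_first[OF R] by (simp add: rigid_first)
    fix p assume "(R \<circ> W) p = ?n"
    then show "first W (first R ?n) \<le> p"
      using rigid_less_first[of p "first R ?n"] Submission.rigid_less_first[OF R, of "W p" ?n] by fastforce
  qed
  then show ?thesis
    by (intro nth_equalityI) (auto simp: act_def rigid_less_first)
qed

text \<open>The value \<open>length V\<close> first occurs in \<open>W\<close> exactly where
  \<open>act V W\<close> ends, so the letter \<open>x\<close> that follows \<open>V\<close> also
  follows \<open>act V W\<close> directly. This is how branching points are traced through
  substitutions.\<close>

lemma act_append_Cons:
  assumes "set s \<subseteq> S" "x \<in> S" "set V \<subseteq> S"
  shows "\<exists>s'. act (V @ x # s) W = act V W @ x # s' \<and> set s' \<subseteq> S"
proof -
  let ?A = "act (V @ x # s) W"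
  let ?m = "first W (length V)"
  have m: "?m < length ?A" using rigid_first_mono[of "length V"] by (simp add: length_act)
  have "?A = take ?m ?A @ ?A ! ?m # drop (Suc ?m) ?A" using m by (rule id_take_nth_drop)
  moreover have "take ?m ?A = act V W"
    by (rule nth_equalityI) (use m rigid_less_first in \<open>auto simp: length_act nth_act nth_append\<close>)
  moreover have "?A ! ?m = x" using m by (simp add: length_act nth_act rigid_first)
  moreover have "set (drop (Suc ?m) ?A) \<subseteq> S"
    using set_drop_subset[of "Suc ?m" ?A] set_act[of "V @ x # s"] assms by auto
  ultimately show ?thesis by (intro exI[of _ "drop (Suc ?m) ?A"]) simp
qed

lemma act_words:
  assumes "V \<in> words a b"
  shows "act V W \<in> words a b"
proof -
  have V: "a \<le> length V" "\<forall>i<a. V ! i = i" "set V = {..<b}" "\<forall>p<length V. \<forall>j<V ! p. \<exists>i<p. V ! i = j"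
    using assms by (auto simp: words_def)
  have len: "a \<le> length (act V W)" using V(1) rigid_le_first[of "length V"] by (simp add: length_act)
  have "\<exists>i<p. act V W ! i = j" if p: "p < length (act V W)" "j < act V W ! p" for p j
  proof -
    have p': "p < first W (length V)" using p by (simp add: length_act)
    then obtain i where i: "i < W p" "V ! i = j"
      using p V(4) rigid_less_first[OF p'] by (auto simp: nth_act)
    then obtain i' where "i' < p" "W i' = i" using rigid_prev[OF W] by blast
    then show ?thesis using p' i by (auto simp: nth_act intro!: exI[of _ i'])
  qed
  moreover have "act V W ! i = i" if "i < a" for i
    using that len V(2) by (auto simp: length_act nth_act rigid_fix[OF W])
  ultimately show ?thesis using len V(3) by (auto simp: words_def set_act)
qed

end

lemma act_id: "act V id = V"
proof -
  have "first id (length V) = length V" unfolding first_def by (rule Least_equality) auto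
  then show ?thesis by (simp add: act_def map_nth)
qed

text \<open>A Galvin-Glazer construction: the initial word is taken from \<open>p\<close>, and the
  blocks are appended one by one from \<open>q\<close>, each with a variable of its own. That each
  block begins with its variable is what later makes first occurrences computable.\<close>

lemma left_variable_sequence:
  assumes a: "a \<ge> 1" and fin: "finite (range (\<phi> :: nat list \<Rightarrow> 'c))"
  obtains X :: "nat \<Rightarrow> nat list" and k where
    "\<And>n. set (X n) \<subseteq> {..<a + n}"
    "\<And>n. \<exists>u. X (Suc n) = X n @ (a + n) # u"
    "\<And>n f. (\<And>i. f i < a) \<Longrightarrow> (\<And>i. i < a \<Longrightarrow> f i = i) \<Longrightarrow> \<phi> (map f (X n)) = k"
proof -
  obtain p q where pq: "ultra p" "ultra q" "p (lists {..<a})" "q {v. \<exists>u. v = a # u \<and> set u \<subseteq> {..a}}"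
    and pid: "\<And>c. c < a \<Longrightarrow> umult p (umap (subst_var a c) q) = p"
    and qid: "\<And>c d. c < a \<Longrightarrow> d < a \<Longrightarrow>
       umult (umap (subst_var a c) q) (umap (subst_var a d) q) = umap (subst_var a c) q"
    by (rule left_variable_ultrafilter[OF a]) blast
  let ?V = "{v. \<exists>u. v = a # u \<and> set u \<subseteq> {..a}}"
  have "p (\<Union>k\<in>range \<phi>. {w. \<phi> w = k})"
    by (rule ultra_mono[OF pq(1) ultra_UNIV[OF pq(1)]]) auto
  then have "\<exists>k\<in>range \<phi>. p {w. \<phi> w = k}" by (rule ultra_finite_UN[OF pq(1) fin])
  then obtain k where k: "p {w. \<phi> w = k}" by (rule bexE)
  define B where "B = {w. \<phi> w = k}"
  \<comment> \<open>\<open>Bs\<close> contains the words of the right colour that also have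
    \<open>q\<close>-many extensions of that colour under every substitution. The identities for
    \<open>p\<close> and \<open>q\<close> make it large and let it reproduce itself, as
    \<open>extend\<close> shows.\<close>
  define Bs where "Bs = B \<inter> (\<Inter>c\<in>{..<a}. {w. q {v. w @ subst_var a c v \<in> B}})"
  have umap_eq: "umap (subst_var a c) q {t. w @ t \<in> C} = q {v. w @ subst_var a c v \<in> C}" for c w C
    by (simp add: umap_def vimage_def)
  have "p Bs"
  proof -
    have "p {w. q {v. w @ subst_var a c v \<in> B}}" if "c < a" for c
    proof -
      have "umult p (umap (subst_var a c) q) B" using k pid[OF that] by (simp add: B_def)
      then show ?thesis by (simp add: umult_def umap_eq)
    qed
    then have "p (\<Inter>c\<in>{..<a}. {w. q {v. w @ subst_var a c v \<in> B}})"
      by (intro ultra_finite_INT[OF pq(1)]) auto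
    then show ?thesis using k by (simp add: Bs_def ultra_Int[OF pq(1)] B_def)
  qed
  have extend: "q {v. w @ subst_var a c v \<in> Bs}" if w: "w \<in> Bs" and c: "c < a" for w c
  proof -
    have 1: "q {v. w @ subst_var a c v \<in> B}" using w c by (auto simp: Bs_def)
    \<comment> \<open>Since the instance \<open>c\<close> of \<open>q\<close> times the instance
      \<open>d\<close> is again the instance \<open>c\<close>, a set that is large for one further
      block is large for two.\<close>
    have "q {v. q {v'. (w @ subst_var a c v) @ subst_var a d v' \<in> B}}" if d: "d < a" for d
    proof -
      have "umult (umap (subst_var a c) q) (umap (subst_var a d) q) {t. w @ t \<in> B}"
        using 1 by (simp add: qid[OF c d] umap_eq)
      then show ?thesis by (simp add: umult_def umap_def vimage_def)
    qed
    then have "q ({v. w @ subst_var a c v \<in> B} \<inter>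
        (\<Inter>d\<in>{..<a}. {v. q {v'. (w @ subst_var a c v) @ subst_var a d v' \<in> B}}))"
      unfolding ultra_Int[OF pq(2)] by (intro conjI 1 ultra_finite_INT[OF pq(2)]) auto
    also have "{v. w @ subst_var a c v \<in> B} \<inter>
        (\<Inter>d\<in>{..<a}. {v. q {v'. (w @ subst_var a c v) @ subst_var a d v' \<in> B}}) =
        {v. w @ subst_var a c v \<in> Bs}"
      by (auto simp: Bs_def)
    finally show ?thesis .
  qed
  define ok where "ok f \<longleftrightarrow> (\<forall>i. f i < a) \<and> (\<forall>i<a. f i = i)" for f :: "nat \<Rightarrow> nat"
  define P where "P n X \<longleftrightarrow> set X \<subseteq> {..<a + n} \<and> (\<forall>f. ok f \<longrightarrow> map f X \<in> Bs)" for n X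
  define Q where "Q n X Y \<longleftrightarrow> (\<exists>u. Y = X @ (a + n) # u)" for n and X Y :: "nat list"
  have "\<exists>X. \<forall>n. P n (X n) \<and> Q n (X n) (X (Suc n))"
  proof (rule dependent_nat_choice)
    have "p (Bs \<inter> lists {..<a})" using \<open>p Bs\<close> pq by (simp only: ultra_Int[OF pq(1)])
    then obtain w where w: "w \<in> Bs" "w \<in> lists {..<a}" using ultra_nonempty[OF pq(1)] by blast
    have "map f w = w" if "ok f" for f
      using w(2) that by (intro map_idI) (auto simp: ok_def)
    then have "P 0 w" using w by (auto simp: P_def)
    then show "\<exists>X. P 0 X" ..
  next
    fix X n assume P: "P n X"
    define F where "F = {map f X | f. ok f}"
    have "F \<subseteq> {w. set w \<subseteq> {..<a} \<and> length w = length X}"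
      by (auto simp: F_def ok_def)
    then have "finite F" by (rule finite_subset) (simp add: finite_lists_length_eq)
    \<comment> \<open>The new block has to suit all earlier substitutions at once; only finitely
      many words \<open>map f X\<close> arise from them.\<close>
    have "q (\<Inter>(w, c)\<in>F \<times> {..<a}. {v. w @ subst_var a c v \<in> Bs})"
      by (rule ultra_finite_INT[OF pq(2)]) (use \<open>finite F\<close> P in \<open>auto simp: F_def P_def intro!: extend\<close>)
    then have "q ((\<Inter>(w, c)\<in>F \<times> {..<a}. {v. w @ subst_var a c v \<in> Bs}) \<inter> ?V)"
      using pq by (simp only: ultra_Int[OF pq(2)])
    then obtain v where v: "v \<in> (\<Inter>(w, c)\<in>F \<times> {..<a}. {v. w @ subst_var a c v \<in> Bs})" "v \<in> ?V"
      using ultra_nonempty[OF pq(2)] by blast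
    obtain u where u: "v = a # u" "set u \<subseteq> {..a}" using v(2) by blast
    let ?Y = "X @ subst_var a (a + n) v"
    have "map f ?Y \<in> Bs" if f: "ok f" for f
    proof -
      have "map f (subst_var a (a + n) v) = subst_var a (f (a + n)) v"
        using f u by (auto simp: subst_var_def ok_def)
      moreover have "map f X \<in> F" using f by (auto simp: F_def)
      moreover have "f (a + n) < a" using f by (auto simp: ok_def)
      ultimately show ?thesis using v(1) by auto
    qed
    moreover have "set ?Y \<subseteq> {..<a + Suc n}"
      using P u by (auto simp: P_def subst_var_def)
    ultimately have "P (Suc n) ?Y" by (simp add: P_def)
    moreover have "Q n X ?Y" using u by (simp add: Q_def subst_var_def)
    ultimately show "\<exists>Y. P (Suc n) Y \<and> Q n X Y" by blast
  qed
  then obtain X where X: "\<And>n. P n (X n)" "\<And>n. Q n (X n) (X (Suc n))" by blast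
  show thesis
  proof (rule that[of X k])
    fix n f assume "\<And>i. f i < a" "\<And>i. i < a \<Longrightarrow> f i = i"
    then have "map f (X n) \<in> Bs" using X(1)[of n] by (auto simp: P_def ok_def)
    then show "\<phi> (map f (X n)) = k" by (simp add: Bs_def B_def)
  qed (use X in \<open>auto simp: P_def Q_def\<close>)
qed

text \<open>The words \<open>Y n\<close> extend one another and converge to \<open>W\<close>. The
  value \<open>a + n\<close> first occurs at position \<open>length (Y n)\<close>, so a word of
  length \<open>a + n\<close> is substituted into exactly \<open>Y n\<close>.\<close>

lemma rigid_of_sequence:
  fixes Y :: "nat \<Rightarrow> nat list"
  assumes Y0: "take a (Y 0) = [0..<a]" "a \<le> length (Y 0)"
    and set: "\<And>n. set (Y n) \<subseteq> {..<a + n}"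
    and step: "\<And>n. \<exists>u. Y (Suc n) = Y n @ (a + n) # u"
  obtains W where "rigid a W" "\<And>V. length V \<ge> a \<Longrightarrow> act V W = map ((!) V) (Y (length V - a))"
proof -
  have len: "n + a \<le> length (Y n)" for n
  proof (induction n)
    case (Suc n) then show ?case using step[of n] by auto
  qed (use Y0 in simp)
  have pref: "\<exists>u. Y (n + m) = Y n @ u" for n m
  proof (induction m)
    case (Suc m) then show ?case using step[of "n + m"] by auto
  qed simp
  \<comment> \<open>Every word with index at least \<open>Suc p\<close> is longer than
    \<open>p\<close>, so the entry is already the final one.\<close>
  define W where "W p = Y (Suc p) ! p" for p
  have W: "W p = Y n ! p" if "p < length (Y n)" for n p
  proof (cases "n \<le> Suc p")
    case True
    then show ?thesis using pref[of n "Suc p - n"] that by (auto simp: W_def nth_append)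
  next
    case False
    then show ?thesis using pref[of "Suc p" "n - Suc p"] len[of "Suc p"] by (auto simp: W_def nth_append)
  qed
  have Wlen: "W (length (Y n)) = a + n" for n
    using W[of "length (Y n)" "Suc n"] step[of n] by (auto simp: nth_append)
  have Wless: "W p < a + n" if "p < length (Y n)" for n p
    using set[of n] nth_mem[OF that] W[OF that] by auto
  have lenmono: "length (Y m) < length (Y n)" if "m < n" for m n
    using Wless[of "length (Y n)" m] Wlen[of n] that by (metis Wlen add_less_cancel_left linorder_neqE_nat not_less_iff_gr_or_eq)
  have Wa: "W i = i" if "i < a" for i
  proof -
    have "Y 0 ! i = take a (Y 0) ! i" using that by simp
    then show ?thesis using W[of i 0] that Y0 by simp
  qed
  have surj: "\<exists>p. W p = j \<and> (\<forall>p'. j < W p' \<longrightarrow> p < p')" for j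
  proof (cases "j < a")
    case True
    moreover have "j < p'" if "j < W p'" for p'
      using that True Wa[of p'] by (cases "p' < a") auto
    ultimately show ?thesis using Wa by blast
  next
    case False
    then have "W (length (Y (j - a))) = j" using Wlen[of "j - a"] by simp
    moreover have "length (Y (j - a)) < p'" if "j < W p'" for p'
      using that Wless[of p' "j - a"] False calculation by (metis le_add_diff_inverse linorder_neqE_nat not_less nless_le)
    ultimately show ?thesis by blast
  qed
  have rigid: "rigid a W"
    unfolding rigid_def by (metis Wa surj surj_def)
  moreover have "act V W = map ((!) V) (Y (length V - a))" if "length V \<ge> a" for V :: "'b list"
  proof -
    let ?n = "length V - a"
    have "first W (length V) = length (Y ?n)"
      unfolding first_def
    proof (rule Least_equality)
      show "W (length (Y ?n)) = length V" using Wlen[of ?n] that by simp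
      show "length (Y ?n) \<le> p" if "W p = length V" for p
        using Wless[of p ?n] that \<open>length V \<ge> a\<close> by fastforce
    qed
    then show ?thesis by (intro nth_equalityI) (auto simp: act_def W)
  qed
  ultimately show thesis using that by blast
qed

text \<open>The parameter-free case. The copy of the alphabet that the coding puts in front is
  absorbed into the colouring.\<close>

lemma Carlson_Simpson_words:
  fixes \<phi> :: "nat list \<Rightarrow> 'c"
  assumes a: "a \<ge> 1" and fin: "finite (range \<phi>)"
  shows "\<exists>W k. rigid a W \<and> (\<forall>V\<in>words a a. \<phi> (act V W) = k)"
proof -
  let ?\<phi> = "\<lambda>w. \<phi> ([0..<a] @ w)"
  have "finite (range ?\<phi>)" using fin by (rule finite_subset[rotated]) auto
  then obtain X k where X: "\<And>n. set (X n) \<subseteq> {..<a + n}"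
    "\<And>n. \<exists>u. X (Suc n) = X n @ (a + n) # u"
    "\<And>n f. (\<And>i. f i < a) \<Longrightarrow> (\<And>i. i < a \<Longrightarrow> f i = i) \<Longrightarrow> ?\<phi> (map f (X n)) = k"
    by (rule left_variable_sequence[OF a]) blast
  define Y where "Y n = [0..<a] @ X n" for n
  obtain W where W: "rigid a W" "\<And>V :: nat list. length V \<ge> a \<Longrightarrow> act V W = map ((!) V) (Y (length V - a))"
  proof (rule rigid_of_sequence[of a Y])
    show "set (Y n) \<subseteq> {..<a + n}" for n using X(1)[of n] by (auto simp: Y_def)
    show "\<exists>u. Y (Suc n) = Y n @ (a + n) # u" for n using X(2)[of n] by (auto simp: Y_def)
  qed (auto simp: Y_def)
  have "\<phi> (act V W) = k" if V: "V \<in> words a a" for V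
  proof -
    have len: "a \<le> length V" and id: "\<And>i. i < a \<Longrightarrow> V ! i = i" and set: "set V = {..<a}"
      using V by (auto simp: words_def)
    let ?n = "length V - a"
    \<comment> \<open>\<open>left_variable_sequence\<close> asks for a total map into the alphabet.
      The default 0 is a letter because \<open>a \<ge> 1\<close>, and it is never read: the entries
      of \<open>X ?n\<close> are below \<open>length V\<close>.\<close>
    define f where "f i = (if i < length V then V ! i else 0)" for i
    have "act V W = map ((!) V) [0..<a] @ map ((!) V) (X ?n)" using W(2)[OF len] by (simp add: Y_def)
    also have "map ((!) V) [0..<a] = [0..<a]" using id by (intro map_idI) auto
    also have "map ((!) V) (X ?n) = map f (X ?n)" using X(1)[of ?n] len by (auto simp: f_def)
    finally have "\<phi> (act V W) = ?\<phi> (map f (X ?n))" by simp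
    also have "\<dots> = k"
    proof (rule X(3))
      show "f i < a" for i using set a nth_mem[of i V] by (auto simp: f_def)
      show "f i = i" if "i < a" for i using that len id by (simp add: f_def)
    qed
    finally show ?thesis .
  qed
  then show ?thesis using W(1) by blast
qed

section \<open>The Carlson-Simpson theorem\<close>

primrec compose_from :: "(nat \<Rightarrow> nat \<Rightarrow> nat) \<Rightarrow> nat \<Rightarrow> nat \<Rightarrow> nat \<Rightarrow> nat" where
  "compose_from R n 0 = id"
| "compose_from R n (Suc m) = R (n + m) \<circ> compose_from R n m"

lemma compose_from_Suc: "compose_from R n (Suc m) p = compose_from R (Suc n) m (R n p)"
  by (induction m) simp_all

text \<open>Since \<open>R n\<close> fixes all values up to \<open>a + n\<close>, every value of the infinite composition
  \<open>\<dots> \<circ> R (n + 1) \<circ> R n\<close> stabilises.\<close>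

lemma rigid_fusion:
  assumes R: "\<And>n. rigid (Suc (a + n)) (R n)"
  obtains T where "\<And>n. rigid (a + n) (T n)" "\<And>n. T n = T (Suc n) \<circ> R n"
proof -
  \<comment> \<open>\<open>p\<close> factors suffice at position \<open>p\<close>: the value is then
    at most \<open>p\<close>, so all later factors fix it.\<close>
  define T where "T n p = compose_from R n p p" for n p
  have rig: "rigid (a + n) (compose_from R n m)" for n m
  proof (induction m)
    case (Suc m)
    have "rigid (a + n) (R (n + m))" by (rule rigid_mono[OF R]) simp
    then show ?case unfolding compose_from.simps using Suc by (rule rigid_comp)
  qed (unfold compose_from.simps, rule rigid_id)
  have const: "compose_from R n m p = compose_from R n k p"
    if "k \<le> m" "compose_from R n k p \<le> a + n + k" for n k m p
    using that(1)
  proof (induction m rule: dec_induct)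
    case (step m)
    then show ?case using rigid_fix[OF R, of "compose_from R n k p" "n + m"] that(2) by simp
  qed simp
  have stable: "compose_from R n m p = T n p" if "p \<le> m" for n m p
    using const[of p m n p] that rigid_le[OF rig, of n p p] by (simp add: T_def)
  have rT: "rigid (a + n) (T n)" for n
    unfolding rigid_def
  proof (intro conjI allI impI)
    show "T n i = i" if "i < a + n" for i
      using rigid_fix[OF rig that] by (simp add: T_def)
    show "surj (T n)"
    proof (rule surjI)
      fix v
      define p where "p = inv (compose_from R n v) v"
      have p: "compose_from R n v p = v"
        unfolding p_def by (rule surj_f_inv_f[OF rigid_surj[OF rig]])
      have "compose_from R n (max v p) p = T n p" by (rule stable) simp
      moreover have "compose_from R n (max v p) p = v" using const[of v "max v p" n p] p by simp
      ultimately show "T n (inv (compose_from R n v) v) = v" by (simp add: p_def)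
    qed
    fix p j assume "j < T n p"
    then have "j < compose_from R n p p" by (simp add: T_def)
    then obtain i where i: "i < p" "compose_from R n p i = j" using rigid_prev[OF rig] by blast
    then show "\<exists>i<p. T n i = j" using stable[of i p n] by auto
  qed
  have "T n = T (Suc n) \<circ> R n" for n
  proof
    fix p
    have "R n p \<le> p" by (rule rigid_le[OF R])
    then have "T (Suc n) (R n p) = compose_from R (Suc n) p (R n p)" by (rule stable[symmetric])
    also have "\<dots> = compose_from R n (Suc p) p" by (rule compose_from_Suc[symmetric])
    also have "\<dots> = T n p" by (rule stable) simp
    finally show "T n p = (T (Suc n) \<circ> R n) p" by simp
  qed
  with rT show thesis by (rule that)
qed

text \<open>Each continuation of \<open>V @ [b]\<close> over \<open>{..b}\<close> is the image,
  under the substitution \<open>V @ [b]\<close>, of a parameter-free word over the alphabet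
  \<open>{..<Suc n}\<close>. The parameter-free case for this larger alphabet therefore applies, to
  all \<open>V\<close> of length \<open>n\<close> simultaneously.\<close>

lemma rigid_one_step:
  fixes \<phi> :: "nat list \<Rightarrow> 'c"
  assumes fin: "finite (range \<phi>)" and W: "rigid c W"
  shows "\<exists>R k. rigid (Suc n) R \<and> (\<forall>V\<in>words a b. \<forall>s. length V = n \<longrightarrow> set s \<subseteq> {..b} \<longrightarrow>
     \<phi> (act (act (V @ b # s) R) W) = k V)"
proof -
  define F where "F = {V \<in> words a b. length V = n}"
  have "F \<subseteq> {V. set V \<subseteq> {..<b} \<and> length V = n}" by (auto simp: F_def words_def)
  then have finF: "finite F" by (rule finite_subset) (simp add: finite_lists_length_eq)
  \<comment> \<open>The colour of \<open>t\<close> is the whole table of colours indexed by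
    \<open>V\<close>; restricting it to the finite set \<open>F\<close> keeps the number of tables
    finite.\<close>
  define \<psi> where "\<psi> t = (\<lambda>V\<in>F. \<phi> (act (map ((!) (V @ [b])) t) W))" for t
  have "range \<psi> \<subseteq> PiE F (\<lambda>_. range \<phi>)" by (auto simp: \<psi>_def)
  then have "finite (range \<psi>)" by (rule finite_subset) (intro finite_PiE finF fin)
  then obtain R k where R: "rigid (Suc n) R" "\<And>t. t \<in> words (Suc n) (Suc n) \<Longrightarrow> \<psi> (act t R) = k"
    using Carlson_Simpson_words[of "Suc n" \<psi>] by auto
  have *: "\<phi> (act (act (V @ b # s) R) W) = k V" if V: "V \<in> F" and s: "set s \<subseteq> {..b}" for V s
  proof -
    have len: "length V = n" and setV: "set V = {..<b}" using V by (auto simp: F_def words_def)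
    have "set (V @ [b]) = {..b}" using setV by (simp add: lessThan_Suc lessThan_Suc_atMost[symmetric])
    have "\<forall>y\<in>set s. \<exists>i. i < Suc n \<and> (V @ [b]) ! i = y"
    proof
      fix y assume "y \<in> set s"
      then have "y \<in> set (V @ [b])" using s \<open>set (V @ [b]) = {..b}\<close> by blast
      then obtain i where "i < length (V @ [b])" "(V @ [b]) ! i = y" unfolding in_set_conv_nth by blast
      then show "\<exists>i. i < Suc n \<and> (V @ [b]) ! i = y" using len by auto
    qed
    from bchoice[OF this] obtain h
      where h: "\<And>y. y \<in> set s \<Longrightarrow> h y < Suc n \<and> (V @ [b]) ! h y = y" by blast
    define t where "t = [0..<Suc n] @ map h s"
    have tw: "t \<in> words (Suc n) (Suc n)"
      unfolding words_def
    proof (intro CollectI conjI allI impI)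
      show "set t = {..<Suc n}" using h by (auto simp: t_def)
      show "t ! i = i" if "i < Suc n" for i using that by (simp add: t_def nth_append del: upt_Suc)
      fix p j assume p: "p < length t" "j < t ! p"
      have "t ! p < Suc n" using nth_mem[OF p(1)] h by (auto simp: t_def)
      show "\<exists>i<p. t ! i = j"
      proof (cases "p < Suc n")
        case True
        then have "t ! p = p" by (simp add: t_def nth_append del: upt_Suc)
        then show ?thesis using p True by (intro exI[of _ j]) (simp add: t_def nth_append del: upt_Suc)
      next
        case False
        then show ?thesis using p \<open>t ! p < Suc n\<close>
          by (intro exI[of _ j]) (simp add: t_def nth_append del: upt_Suc)
      qed
    qed (simp add: t_def)
    have "map ((!) (V @ [b])) t = V @ b # s"
    proof -
      have "map ((!) (V @ [b])) [0..<Suc n] = V @ [b]" using map_nth[of "V @ [b]"] len by (simp del: upt_Suc)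
      moreover have "map ((!) (V @ [b])) (map h s) = s" unfolding map_map by (intro map_idI) (use h in auto)
      ultimately show ?thesis by (simp add: t_def del: upt_Suc)
    qed
    then have "\<psi> (act t R) V = \<phi> (act (act (V @ b # s) R) W)"
      using V by (simp add: \<psi>_def map_act[OF R(1)])
    then show ?thesis using R(2)[OF tw] by simp
  qed
  then show ?thesis using R(1) unfolding F_def by blast
qed

text \<open>Makes the colour independent of everything after the first occurrence of the last
  parameter. The lengths of \<open>V\<close> are handled one after another; the step for length
  \<open>a + n\<close> fixes all values up to \<open>a + n\<close>, so the infinitely many steps can
  be fused.\<close>

lemma end_homogeneous:
  fixes \<phi> :: "nat list \<Rightarrow> 'c"
  assumes fin: "finite (range \<phi>)"
  shows "\<exists>T k. rigid a T \<and> (\<forall>V\<in>words a b. \<forall>s. set s \<subseteq> {..b} \<longrightarrow> \<phi> (act (V @ b # s) T) = k V)"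
proof -
  define good where "good n W R k \<longleftrightarrow> rigid (Suc (a + n)) R \<and> (\<forall>V\<in>words a b. \<forall>s. length V = a + n \<longrightarrow>
     set s \<subseteq> {..b} \<longrightarrow> \<phi> (act (act (V @ b # s) R) W) = k V)" for n W R k
  define nxt where "nxt n W = (SOME R. \<exists>k. good n W R k)" for n W
  have nxtI: "\<exists>k. good n W (nxt n W) k" if W: "rigid a W" for n W
  proof -
    have "\<exists>R. \<exists>k. good n W R k"
      using rigid_one_step[OF fin W, of "a + n" a b] unfolding good_def .
    then have "\<exists>k. good n W (SOME R. \<exists>k. good n W R k) k" by (rule someI_ex[of "\<lambda>R. \<exists>k. good n W R k"])
    then show ?thesis unfolding nxt_def .
  qed
  define W where "W = rec_nat id (\<lambda>n W. nxt n W \<circ> W)"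
  have W0: "W 0 = id" and WSuc: "W (Suc n) = nxt n (W n) \<circ> W n" for n by (simp_all add: W_def)
  have rigW: "rigid a (W n)" for n
  proof (induction n)
    case (Suc n)
    then have "rigid a (nxt n (W n))" using nxtI[of "W n" n] by (auto simp: good_def intro: rigid_mono)
    then show ?case unfolding WSuc using Suc by (rule rigid_comp)
  qed (unfold W0, rule rigid_id)
  have "\<forall>n. \<exists>k. good n (W n) (nxt n (W n)) k" using nxtI[OF rigW] by (intro allI)
  from choice[OF this] obtain K where "\<forall>n. good n (W n) (nxt n (W n)) (K n)" by (rule exE)
  then have K: "good n (W n) (nxt n (W n)) (K n)" for n by (rule spec)
  have rigR: "rigid (Suc (a + n)) (nxt n (W n))" for n using K by (auto simp: good_def)
  obtain T where T: "\<And>n. rigid (a + n) (T n)" "\<And>n. T n = T (Suc n) \<circ> nxt n (W n)"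
    using rigid_fusion[of a "\<lambda>n. nxt n (W n)"] rigR by blast
  have T0: "T 0 = T n \<circ> W n" for n
  proof (induction n)
    case (Suc n)
    then show ?case by (simp only: T(2)[of n] WSuc o_assoc)
  qed (simp only: W0 o_id)
  have "\<phi> (act (V @ b # s) (T 0)) = K (length V - a) V"
    if V: "V \<in> words a b" and s: "set s \<subseteq> {..b}" for V s
  proof -
    define n where "n = length V - a"
    have n: "length V = a + n" using V by (auto simp: n_def words_def)
    have setV: "set V \<subseteq> {..b}" using V by (auto simp: words_def)
    \<comment> \<open>The factors after step \<open>n\<close> fix all values up to
      \<open>a + n\<close>. They change only what follows \<open>V @ [b]\<close>, and on that the
      colour achieved at step \<open>n\<close> does not depend.\<close>
    have "act V (T (Suc n)) = act V id"
    proof (rule nth_equalityI)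
      have f: "first (T (Suc n)) (length V) = length V"
        by (rule rigid_first_id[OF T(1)]) (simp add: n)
      then show "length (act V (T (Suc n))) = length (act V id)"
        by (simp add: length_act[OF T(1)] act_id)
      fix i assume "i < length (act V (T (Suc n)))"
      then have i: "i < length V" using f by (simp add: length_act[OF T(1)])
      then show "act V (T (Suc n)) ! i = act V id ! i"
        using f n rigid_fix[OF T(1), of i "Suc n"] by (simp add: nth_act[OF T(1)] act_id)
    qed
    then have fixV: "act V (T (Suc n)) = V" by (simp add: act_id)
    have "\<exists>s'. act (V @ b # s) (T (Suc n)) = act V (T (Suc n)) @ b # s' \<and> set s' \<subseteq> {..b}"
      by (rule act_append_Cons[OF T(1) s _ setV]) simp
    then obtain s' where s': "act (V @ b # s) (T (Suc n)) = act V (T (Suc n)) @ b # s'" "set s' \<subseteq> {..b}"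
      by blast
    have "act (V @ b # s) (T 0) = act (act (V @ b # s) (T (Suc n))) (W (Suc n))"
      unfolding T0[of "Suc n"] by (rule act_comp[OF rigW T(1)])
    also have "\<dots> = act (act (V @ b # s') (nxt n (W n))) (W n)"
      unfolding WSuc s'(1) fixV by (rule act_comp[OF rigW rigR])
    finally show ?thesis
      using K[of n] V s'(2) n unfolding good_def n_def by simp
  qed
  then show ?thesis using T(1)[of 0] by (intro exI[of _ "T 0"]) auto
qed

lemma words_Suc_split:
  assumes "V \<in> words a (Suc b)" "a \<le> b"
  obtains V' s where "V = V' @ b # s" "V' \<in> words a b" "set s \<subseteq> {..b}"
proof -
  have V: "a \<le> length V" "\<forall>i<a. V ! i = i" "set V = {..b}" "\<forall>p<length V. \<forall>j<V ! p. \<exists>i<p. V ! i = j"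
    using assms(1) by (auto simp: words_def lessThan_Suc_atMost)
  then have "b \<in> set V" by simp
  then obtain V' s where e: "V = V' @ b # s" "b \<notin> set V'" by (meson split_list_first)
  have "a \<le> length V'"
  proof (rule ccontr)
    assume "\<not> a \<le> length V'"
    then have "V ! length V' = length V'" using V(2) by simp
    then show False using e \<open>\<not> a \<le> length V'\<close> assms(2) by simp
  qed
  moreover have "set V' = {..<b}"
  proof
    show "set V' \<subseteq> {..<b}" using e V(3) by (metis Un_iff atMost_iff lessThan_iff order_le_less set_append subsetI)
    show "{..<b} \<subseteq> set V'"
    proof
      fix j assume "j \<in> {..<b}"
      then obtain i where "i < length V'" "V ! i = j" using V(4) e by (force dest: spec[of _ "length V'"])
      then show "j \<in> set V'" using e by (auto simp: nth_append)
    qed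
  qed
  moreover have nth: "V' ! i = V ! i" if "i < length V'" for i using that e by (simp add: nth_append)
  moreover have "\<exists>i<p. V' ! i = j" if "p < length V'" "j < V' ! p" for p j
  proof -
    have "p < length V" "j < V ! p" using that nth[OF that(1)] e(1) by simp_all
    then obtain i where "i < p" "V ! i = j" using V(4) by blast
    then show ?thesis using nth[of i] that(1) by auto
  qed
  ultimately have "V' \<in> words a b"
    using V(2) unfolding words_def by auto
  moreover have "set s \<subseteq> {..b}" using V(3) e by auto
  ultimately show thesis using e(1) that by blast
qed

text \<open>Induction on the number of parameters: once the colour ignores what follows the first
  occurrence of the last parameter, it is a colouring of the words before it, which have one
  parameter less.\<close>

theorem Carlson_Simpson:
  fixes \<phi> :: "nat list \<Rightarrow> 'c"
  assumes a: "a \<ge> 1" and fin: "finite (range \<phi>)"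
  shows "\<exists>W c. rigid a W \<and> (\<forall>V\<in>words a (a + k). \<phi> (act V W) = c)"
  using fin
proof (induction k arbitrary: \<phi>)
  case 0
  then show ?case using Carlson_Simpson_words[OF a] by simp
next
  case (Suc k)
  let ?b = "a + k"
  obtain T K where T: "rigid a T"
    "\<And>V s. V \<in> words a ?b \<Longrightarrow> set s \<subseteq> {..?b} \<Longrightarrow> \<phi> (act (V @ ?b # s) T) = K V"
    using end_homogeneous[OF Suc.prems, of a ?b] by auto
  have "finite (range (\<lambda>V. \<phi> (act (V @ [?b]) T)))"
    using Suc.prems by (rule finite_subset[rotated]) auto
  then obtain R c where R: "rigid a R" "\<And>V. V \<in> words a ?b \<Longrightarrow> \<phi> (act (act V R @ [?b]) T) = c"
    using Suc.IH by blast
  have "\<phi> (act V (R \<circ> T)) = c" if "V \<in> words a (a + Suc k)" for V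
  proof -
    have "V \<in> words a (Suc ?b)" using that by simp
    then obtain V' s where V: "V = V' @ ?b # s" "V' \<in> words a ?b" "set s \<subseteq> {..?b}"
      by (rule words_Suc_split) auto
    have V': "act V' R \<in> words a ?b" by (rule act_words[OF R(1) V(2)])
    have "set V' \<subseteq> {..?b}" using V(2) by (auto simp: words_def)
    then have "\<exists>s'. act V R = act V' R @ ?b # s' \<and> set s' \<subseteq> {..?b}"
      unfolding V(1) by (intro act_append_Cons[OF R(1) V(3)]) simp_all
    then obtain s' where s': "act V R = act V' R @ ?b # s'" "set s' \<subseteq> {..?b}" by blast
    have "\<phi> (act V (R \<circ> T)) = \<phi> (act (act V R) T)" by (simp only: act_comp[OF T(1) R(1)])
    also have "\<dots> = K (act V' R)" unfolding s'(1) by (rule T(2)[OF V' s'(2)])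
    also have "\<dots> = \<phi> (act (act V' R @ [?b]) T)" using T(2)[OF V', of "[]"] by simp
    also have "\<dots> = c" by (rule R(2)[OF V(2)])
    finally show ?thesis .
  qed
  then show ?case using rigid_comp[OF R(1) T(1)] by blast
qed

section \<open>Patterns of finite sets\<close>

definition rank_in :: "('a \<Rightarrow> 'a \<Rightarrow> bool) \<Rightarrow> 'a set \<Rightarrow> 'a \<Rightarrow> nat" where
  "rank_in lt S x = card {y \<in> S. lt y x}"

lemma strict_linear_on_less: "strict_linear_on S ((<) :: 'a::linorder \<Rightarrow> 'a \<Rightarrow> bool)"
  by (auto simp: strict_linear_on_def)

context
  fixes S :: "'a set" and lt
  assumes fin: "finite S" and lin: "strict_linear_on S lt"
begin

lemma rank_in_less: "x \<in> S \<Longrightarrow> y \<in> S \<Longrightarrow> lt x y \<Longrightarrow> rank_in lt S x < rank_in lt S y"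
  unfolding rank_in_def
proof (rule psubset_card_mono)
  assume *: "x \<in> S" "y \<in> S" "lt x y"
  then have "x \<notin> {z \<in> S. lt z x}" "x \<in> {z \<in> S. lt z y}" using lin by (auto simp: strict_linear_on_def)
  moreover have "{z \<in> S. lt z x} \<subseteq> {z \<in> S. lt z y}" using * lin unfolding strict_linear_on_def by blast
  ultimately show "{z \<in> S. lt z x} \<subset> {z \<in> S. lt z y}" by blast
qed (use fin in simp)

lemma rank_in_less_iff: "x \<in> S \<Longrightarrow> y \<in> S \<Longrightarrow> rank_in lt S x < rank_in lt S y \<longleftrightarrow> lt x y"
  using rank_in_less[of x y] rank_in_less[of y x] lin unfolding strict_linear_on_def
  by (metis less_asym less_irrefl)

lemma bij_betw_rank_in: "bij_betw (rank_in lt S) S {..<card S}"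
proof -
  have inj: "inj_on (rank_in lt S) S"
    using lin rank_in_less unfolding strict_linear_on_def inj_on_def by (metis less_irrefl)
  have "rank_in lt S x < card S" if "x \<in> S" for x
    unfolding rank_in_def
  proof (rule psubset_card_mono[OF fin])
    have "\<not> lt x x" using that lin by (simp add: strict_linear_on_def)
    then have "x \<notin> {y \<in> S. lt y x}" by simp
    then show "{y \<in> S. lt y x} \<subset> S" using that by blast
  qed
  then have "rank_in lt S ` S \<subseteq> {..<card S}" by auto
  moreover have "card (rank_in lt S ` S) = card {..<card S}" using card_image[OF inj] by simp
  ultimately have "rank_in lt S ` S = {..<card S}" by (intro card_subset_eq) auto
  with inj show ?thesis by (simp add: bij_betw_def)
qed

end

section \<open>Standardisation and level sequences\<close>

definition standardize :: "nat list \<Rightarrow> nat list" where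
  "standardize L = map (rank_in (<) (set L)) L"

lemma length_standardize [simp]: "length (standardize L) = length L"
  by (simp add: standardize_def)

lemma nth_standardize: "j < length L \<Longrightarrow> standardize L ! j = rank_in (<) (set L) (L ! j)"
  by (simp add: standardize_def)

lemma standardize_alternating:
  assumes "distinct L" "alternating L"
  shows "standardize L \<in> alternating_on {..<length L}"
proof -
  have b: "bij_betw (rank_in (<) (set L)) (set L) {..<card (set L)}"
    by (rule bij_betw_rank_in[OF finite_set strict_linear_on_less])
  have "distinct (standardize L)" "set (standardize L) = {..<length L}"
    using b assms(1) by (auto simp: standardize_def distinct_map bij_betw_def distinct_card)
  moreover have "alternating (standardize L)"
    using assms(2) unfolding alternating_def
    by (auto simp: nth_standardize rank_in_less_iff[OF finite_set strict_linear_on_less])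
  ultimately show ?thesis by (simp add: alternating_on_def)
qed

lemma standardize_map_strict_mono:
  assumes "set t = {..<n}" "strict_mono_on {..<n} v"
  shows "standardize (map v t) = t"
proof -
  have "rank_in (<) (v ` {..<n}) (v i) = i" if "i < n" for i
  proof -
    have "{w \<in> v ` {..<n}. w < v i} = v ` {..<i}"
      using that assms(2) by (auto simp: strict_mono_on_less)
    moreover have "inj_on v {..<i}"
      using strict_mono_on_imp_inj_on[OF assms(2)] that by (auto intro: inj_on_subset)
    ultimately show ?thesis by (simp add: rank_in_def card_image)
  qed
  moreover have "set (map v t) = v ` {..<n}" by (simp add: assms(1))
  ultimately have "rank_in (<) (set (map v t)) (v i) = i" if "i \<in> set t" for i
    using that assms(1) by simp
  then show ?thesis unfolding standardize_def by (simp add: comp_def map_idI)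
qed

definition levels :: "('b \<Rightarrow> nat) \<Rightarrow> ('b \<Rightarrow> 'b \<Rightarrow> nat) \<Rightarrow> 'b list \<Rightarrow> nat list" where
  "levels r d xs = map (\<lambda>j. if even j then r (xs ! (j div 2)) else d (xs ! (j div 2)) (xs ! Suc (j div 2)))
     [0..<2 * length xs - 1]"

lemma length_levels [simp]: "length (levels r d xs) = 2 * length xs - 1"
  by (simp add: levels_def)

lemma nth_levels_even: "i < length xs \<Longrightarrow> levels r d xs ! (2 * i) = r (xs ! i)"
  by (simp add: levels_def)

lemma nth_levels_odd: "Suc i < length xs \<Longrightarrow> levels r d xs ! Suc (2 * i) = d (xs ! i) (xs ! Suc i)"
  by (simp add: levels_def)

lemma levels_index_cases:
  assumes "j < 2 * m - 1"
  obtains i where "i < m" "j = 2 * i" | i where "Suc i < m" "j = Suc (2 * i)"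
proof (cases "even j")
  case True
  then obtain i where "j = 2 * i" by (rule evenE)
  then show thesis using that(1)[of i] assms by simp
next
  case False
  then obtain i where "j = 2 * i + 1" by (rule oddE)
  then show thesis using that(2)[of i] assms by simp
qed

text \<open>The colour of the \<open>i\<close>-th point of \<open>X\<close> in increasing order.
  Copies depend on \<open>X\<close> only through these colours and the number of points.\<close>

definition pattern_colour :: "'a set \<Rightarrow> ('a \<Rightarrow> 'a \<Rightarrow> bool) \<Rightarrow> ('a \<Rightarrow> nat) \<Rightarrow> nat \<Rightarrow> nat" where
  "pattern_colour A lt col i = col (inv_into A (rank_in lt A) i)"

lemma copies_iff:
  assumes "finite A" "strict_linear_on A lt"
  shows "S \<in> copies c A lt col \<longleftrightarrow>
    (\<exists>ys. sorted_wrt (<) ys \<and> set ys = S \<and> length ys = card A \<and>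
      (\<forall>i<card A. c (ys ! i) = pattern_colour A lt col i))"
proof
  let ?g = "rank_in lt A"
  let ?h = "inv_into A ?g"
  have b: "bij_betw ?g A {..<card A}" by (rule bij_betw_rank_in[OF assms])
  have hA: "?h i \<in> A" "?g (?h i) = i" if "i < card A" for i
    using that b by (auto simp: bij_betw_def intro: inv_into_into f_inv_into_f)
  have hg: "?h (?g x) = x" if "x \<in> A" for x
    using that b by (simp add: bij_betw_def)
  have less: "?g x < ?g y \<longleftrightarrow> lt x y" if "x \<in> A" "y \<in> A" for x y
    by (rule rank_in_less_iff[OF assms that])
  {
    assume "S \<in> copies c A lt col"
    then obtain f where f: "bij_betw f A S" "\<forall>x\<in>A. \<forall>y\<in>A. lt x y \<longleftrightarrow> f x < f y" "\<forall>x\<in>A. c (f x) = col x"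
      by (auto simp: copies_def)
    let ?ys = "map (\<lambda>i. f (?h i)) [0..<card A]"
    have "sorted_wrt (<) ?ys"
      unfolding sorted_wrt_iff_nth_less
    proof (intro allI impI)
      fix i j assume ij: "i < j" "j < length ?ys"
      then have "lt (?h i) (?h j)" using less[of "?h i" "?h j"] hA[of i] hA[of j] by simp
      then have "f (?h i) < f (?h j)" using f(2) hA ij by simp
      then show "?ys ! i < ?ys ! j" using ij by simp
    qed
    moreover have "set ?ys = S"
    proof -
      have "bij_betw ?h {..<card A} A" by (rule bij_betw_inv_into[OF b])
      then have "f ` ?h ` {..<card A} = S" using f(1) by (simp add: bij_betw_def)
      then show ?thesis by (simp add: image_image lessThan_atLeast0)
    qed
    moreover have "\<forall>i<card A. c (?ys ! i) = pattern_colour A lt col i"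
      using f(3) hA by (simp add: pattern_colour_def)
    ultimately show "\<exists>ys. sorted_wrt (<) ys \<and> set ys = S \<and> length ys = card A \<and>
      (\<forall>i<card A. c (ys ! i) = pattern_colour A lt col i)" by (intro exI[of _ ?ys]) simp
  next
    assume "\<exists>ys. sorted_wrt (<) ys \<and> set ys = S \<and> length ys = card A \<and>
      (\<forall>i<card A. c (ys ! i) = pattern_colour A lt col i)"
    then obtain ys where ys: "sorted_wrt (<) ys" "set ys = S" "length ys = card A"
      "\<forall>i<card A. c (ys ! i) = pattern_colour A lt col i" by blast
    have glt: "?g x < card A" if "x \<in> A" for x using b that by (auto simp: bij_betw_def)
    have ysl: "ys ! i < ys ! j \<longleftrightarrow> i < j" if "i < card A" "j < card A" for i j
      using ys(1,3) that sorted_wrt_nth_less[of "(<)" ys]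
      by (metis linorder_neqE_nat order_less_asym order_less_irrefl)
    have "bij_betw ((!) ys) {..<card A} S"
      using ys strict_sorted_iff[of ys] by (intro bij_betw_nth) auto
    then have "bij_betw ((!) ys \<circ> ?g) A S" using b by (intro bij_betw_trans)
    moreover have "\<forall>x\<in>A. c (((!) ys \<circ> ?g) x) = col x"
      using ys(4) glt hg by (simp add: pattern_colour_def)
    moreover have "\<forall>x\<in>A. \<forall>y\<in>A. lt x y \<longleftrightarrow> ((!) ys \<circ> ?g) x < ((!) ys \<circ> ?g) y"
    proof (intro ballI)
      fix x y assume xy: "x \<in> A" "y \<in> A"
      show "lt x y \<longleftrightarrow> ((!) ys \<circ> ?g) x < ((!) ys \<circ> ?g) y"
        unfolding o_apply ysl[OF glt[OF xy(1)] glt[OF xy(2)]] by (rule less[OF xy, symmetric])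
    qed
    ultimately show "S \<in> copies c A lt col" unfolding copies_def by blast
  }
qed

lemma pattern_colour_less:
  assumes "in_P n A lt col" "i < card A"
  shows "pattern_colour A lt col i < n"
proof -
  have "bij_betw (rank_in lt A) A {..<card A}"
    by (rule bij_betw_rank_in) (use assms in \<open>auto simp: in_P_def\<close>)
  then have "inv_into A (rank_in lt A) i \<in> A"
    using assms(2) by (intro inv_into_into) (auto simp: bij_betw_def)
  then show ?thesis using assms(1) by (simp add: pattern_colour_def in_P_def)
qed

section \<open>The upper bound\<close>

text \<open>Positions \<open>p\<close> of the binary sequences code cuts of the rational line: \<open>cut p x\<close> says that the
  \<open>p\<close>-th cut lies to the left of \<open>x\<close>.  Every rational \<open>q\<close> yields a cut directly before \<open>q\<close>, one directly
  after \<open>q\<close>, and then the level of \<open>q\<close> itself; hence the meet of two rationals precedes both of their levels.\<close>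

definition cut :: "nat \<Rightarrow> rat \<Rightarrow> bool" where
  "cut p x \<longleftrightarrow> from_nat (p div 3) < x \<or> (from_nat (p div 3) = x \<and> p mod 3 = 0)"

definition leaf_level :: "rat \<Rightarrow> nat" where
  "leaf_level x = 3 * to_nat x + 2"

definition meet_level :: "rat \<Rightarrow> rat \<Rightarrow> nat" where
  "meet_level x y = (LEAST p. \<not> cut p x \<and> cut p y)"

lemma cut_mono: "cut p x \<Longrightarrow> x \<le> y \<Longrightarrow> cut p y"
  by (auto simp: cut_def)

lemma cut_leaf_level: "cut (leaf_level z) x \<longleftrightarrow> z < x"
proof -
  have "leaf_level z div 3 = to_nat z" "leaf_level z mod 3 = 2"
    unfolding leaf_level_def by presburger+
  then show ?thesis by (simp add: cut_def)
qed

lemma leaf_level_inj: "leaf_level x = leaf_level y \<longleftrightarrow> x = y"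
  by (simp add: leaf_level_def)

context
  fixes x y :: rat assumes xy: "x < y"
begin

lemma meet_level_before_leaf:
  "\<not> cut (3 * to_nat y) x" "cut (3 * to_nat y) y" "\<not> cut (3 * to_nat x + 1) x" "cut (3 * to_nat x + 1) y"
proof -
  have "(3 * to_nat x + 1) div 3 = to_nat x" "(3 * to_nat x + 1) mod 3 = 1" by auto
  then show "\<not> cut (3 * to_nat x + 1) x" "cut (3 * to_nat x + 1) y" using xy by (auto simp: cut_def)
  show "\<not> cut (3 * to_nat y) x" "cut (3 * to_nat y) y" using xy by (auto simp: cut_def)
qed

lemma meet_level_cut: "\<not> cut (meet_level x y) x" "cut (meet_level x y) y"
  using LeastI[of "\<lambda>p. \<not> cut p x \<and> cut p y", OF conjI[OF meet_level_before_leaf(1,2)]]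
  by (simp_all add: meet_level_def)

lemma meet_level_le: "\<not> cut p x \<Longrightarrow> cut p y \<Longrightarrow> meet_level x y \<le> p"
  unfolding meet_level_def by (rule Least_le) simp

lemma cut_before_meet: "p < meet_level x y \<Longrightarrow> cut p x \<longleftrightarrow> cut p y"
  using meet_level_le[of p] cut_mono[of p x y] xy by force

lemma meet_level_less_leaf: "meet_level x y < leaf_level x" "meet_level x y < leaf_level y"
  using meet_level_le[OF meet_level_before_leaf(1,2)] meet_level_le[OF meet_level_before_leaf(3,4)]
  by (simp_all add: leaf_level_def)

text \<open>The cut at the level of \<open>z\<close> is the same as the one a position earlier,
  directly after \<open>z\<close>; so a level is never the first position that separates two
  rationals.\<close>

lemma meet_level_neq_leaf: "meet_level x y \<noteq> leaf_level z"
proof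
  assume eq: "meet_level x y = leaf_level z"
  then have z: "x \<le> z" "z < y" using meet_level_cut by (auto simp: cut_leaf_level)
  have "(3 * to_nat z + 1) div 3 = to_nat z" "(3 * to_nat z + 1) mod 3 = 1" by auto
  then have "\<not> cut (3 * to_nat z + 1) x" "cut (3 * to_nat z + 1) y" using z by (auto simp: cut_def)
  then show False using meet_level_le eq by (fastforce simp: leaf_level_def)
qed

end

section \<open>Code words and their common envelope\<close>

lemma upt_split: "p < n \<Longrightarrow> [0..<n] = [0..<p] @ p # [Suc p..<n]"
  using upt_add_eq_append[of 0 p "n - p"] upt_conv_Cons[of p n] by simp

text \<open>Reads the envelope from the viewpoint of the \<open>i\<close>-th point. Parameter
  \<open>2 + t ! j\<close> stands for the cut at entry \<open>j\<close> of the level sequence, which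
  lies to the left of that point iff \<open>j < 2 * i\<close>. Only the type is consulted.\<close>

definition eval_letter :: "nat list \<Rightarrow> nat \<Rightarrow> nat \<Rightarrow> nat" where
  "eval_letter t i x = (if x < 2 then x else if x - 2 \<in> set (take (2 * i) t) then 1 else 0)"

definition bits :: "rat \<Rightarrow> nat list" where
  "bits x = [0, 1] @ map (\<lambda>p. if cut p x then 1 else 0) [0..<leaf_level x]"

context
  fixes xs :: "rat list" and L :: "nat list" and m :: nat
  assumes sorted: "sorted_wrt (<) xs" and m: "length xs = m" and L: "L = levels leaf_level meet_level xs"
begin

lemma sorted_nth_less: "i < j \<Longrightarrow> j < m \<Longrightarrow> xs ! i < xs ! j"
  using sorted m by (auto simp: sorted_wrt_iff_nth_less)

lemma sorted_nth_le: "i \<le> j \<Longrightarrow> j < m \<Longrightarrow> xs ! i \<le> xs ! j"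
  using sorted_nth_less[of i j] by (cases "i = j") auto

lemma length_levels_leaf_meet: "length L = 2 * m - 1"
  by (simp add: L m)

lemma levels_leaf: "i < m \<Longrightarrow> L ! (2 * i) = leaf_level (xs ! i)"
  by (simp add: L m nth_levels_even)

lemma levels_meet: "Suc i < m \<Longrightarrow> L ! Suc (2 * i) = meet_level (xs ! i) (xs ! Suc i)"
  by (simp add: L m nth_levels_odd)

lemma cut_levels:
  assumes "j < 2 * m - 1" "i < m" "j \<noteq> 2 * i"
  shows "cut (L ! j) (xs ! i) \<longleftrightarrow> j < 2 * i"
  using assms(1)
proof (cases rule: levels_index_cases)
  case (1 k)
  then show ?thesis
    using sorted_nth_less[of k i] sorted_nth_less[of i k] assms
    by (cases i k rule: linorder_cases) (auto simp: levels_leaf cut_leaf_level)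
next
  case (2 k)
  note c = meet_level_cut[OF sorted_nth_less[of k "Suc k"]]
  show ?thesis
  proof (cases "k < i")
    case True
    then show ?thesis using 2 c(2) cut_mono[OF _ sorted_nth_le[of "Suc k" i]] assms by (simp add: levels_meet)
  next
    case False
    then show ?thesis using 2 c(1) cut_mono[OF _ sorted_nth_le[of i k]] assms by (auto simp: levels_meet)
  qed
qed

text \<open>Levels differ by injectivity, and a meet is never a level. For a meet with a larger
  index, the cut does not lie to the left of \<open>xs ! i\<close>, whereas the cuts of all entries
  before position \<open>2 * i\<close> do.\<close>

lemma distinct_levels: "distinct L"
proof -
  have neq: "L ! j \<noteq> L ! k" if jk: "j < k" "k < 2 * m - 1" for j k
    using jk(2)
  proof (cases rule: levels_index_cases)
    case (1 i)
    have "j < 2 * m - 1" using jk by simp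
    then show ?thesis
    proof (cases rule: levels_index_cases)
      case (1 i')
      then show ?thesis using \<open>k = 2 * i\<close> \<open>i < m\<close> jk sorted_nth_less[of i' i] by (simp add: levels_leaf leaf_level_inj)
    next
      case (2 i')
      then show ?thesis using \<open>k = 2 * i\<close> \<open>i < m\<close> meet_level_neq_leaf[OF sorted_nth_less[of i' "Suc i'"]]
        by (simp add: levels_leaf levels_meet)
    qed
  next
    case (2 i)
    have c: "\<not> cut (L ! k) (xs ! i)" using cut_levels[of k i] 2 by simp
    show ?thesis
    proof (cases "j = 2 * i")
      case True
      then show ?thesis using 2 meet_level_neq_leaf[OF sorted_nth_less[of i "Suc i"], of "xs ! i"]
        by (simp add: levels_leaf levels_meet)
    next
      case False
      then have "j < 2 * i" using jk 2 by simp
      then have "cut (L ! j) (xs ! i)" using cut_levels[of j i] 2 False by simp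
      then show ?thesis using c by metis
    qed
  qed
  show ?thesis unfolding distinct_conv_nth length_levels_leaf_meet
    using neq by (metis linorder_neqE_nat)
qed

lemma alternating_levels: "m \<ge> 1 \<Longrightarrow> alternating L"
  unfolding alternating_def length_levels_leaf_meet
proof (intro conjI allI impI)
  fix j assume "m \<ge> 1" and j: "Suc j < 2 * m - 1"
  show "if even j then L ! Suc j < L ! j else L ! j < L ! Suc j"
  proof (cases "even j")
    case True
    then obtain i where i: "j = 2 * i" by (rule evenE)
    then have "Suc i < m" using j by simp
    then show ?thesis using i meet_level_less_leaf(1)[OF sorted_nth_less[of i "Suc i"]]
      by (simp add: levels_leaf levels_meet)
  next
    case False
    then obtain i where i: "j = Suc (2 * i)" by (auto elim: oddE)
    then have "Suc i < m" using j by simp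
    then show ?thesis using i meet_level_less_leaf(2)[OF sorted_nth_less[of i "Suc i"]] levels_leaf[of "Suc i"]
      by (simp add: levels_meet)
  qed
qed auto

text \<open>The number of points of \<open>xs\<close> to the left of the cut; the disjunct
  \<open>i = m\<close> covers cuts to the right of all points.\<close>

definition cut_index :: "nat \<Rightarrow> nat" where
  "cut_index p = (LEAST i. i = m \<or> cut p (xs ! i))"

lemma cut_index_le: "cut_index p \<le> m"
  unfolding cut_index_def by (rule Least_le) simp

lemma cut_iff_cut_index: "i < m \<Longrightarrow> cut p (xs ! i) \<longleftrightarrow> cut_index p \<le> i"
proof
  assume "i < m" "cut_index p \<le> i"
  moreover have "cut_index p = m \<or> cut p (xs ! cut_index p)"
    unfolding cut_index_def by (rule LeastI[of "\<lambda>i. i = m \<or> cut p (xs ! i)" m]) simp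
  ultimately show "cut p (xs ! i)" using cut_mono[OF _ sorted_nth_le] by auto
qed (auto simp: cut_index_def intro: Least_le)

text \<open>The letter at a position that is not a level of \<open>xs\<close> is the parameter of the meet of those
  two neighbouring elements of \<open>xs\<close> that the cut separates.\<close>

definition letter :: "nat \<Rightarrow> nat" where
  "letter p = (if p \<in> set L then 2 + rank_in (<) (set L) p
     else if cut_index p = 0 then 1
     else if cut_index p = m then 0
     else 2 + rank_in (<) (set L) (L ! (2 * cut_index p - 1)))"

definition envelope :: "nat list" where
  "envelope = [0, 1] @ map letter [0..<Suc (Max (set L))]"

lemma letter_cases:
  assumes "letter p \<ge> 2"
  obtains v where "v \<in> set L" "v \<le> p" "letter p = 2 + rank_in (<) (set L) v"
proof (cases "p \<in> set L")
  case True
  then show thesis using that[of p] by (simp add: letter_def)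
next
  case False
  then have c: "cut_index p \<noteq> 0" "cut_index p \<noteq> m"
    "letter p = 2 + rank_in (<) (set L) (L ! (2 * cut_index p - 1))"
    using assms by (auto simp: letter_def split: if_splits)
  define i where "i = cut_index p - 1"
  have i: "cut_index p = Suc i" "Suc i < m" using c cut_index_le[of p] by (auto simp: i_def)
  have "meet_level (xs ! i) (xs ! Suc i) \<le> p"
    by (rule meet_level_le) (use i cut_iff_cut_index[of i p] cut_iff_cut_index[of "Suc i" p] sorted_nth_less in auto)
  then have "L ! (2 * cut_index p - 1) \<le> p" using i by (simp add: levels_meet)
  moreover have "L ! (2 * cut_index p - 1) \<in> set L" using i length_levels_leaf_meet by (intro nth_mem) simp
  ultimately show thesis using that c(3) by blast
qed

text \<open>Parameters are numbered by the rank of their levels, and each occurs at its own level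
  and not earlier. They therefore appear in increasing order, and there are \<open>2 * m - 1\<close>
  of them because the levels are distinct. The offset 2 belongs to the letters 0 and 1.\<close>

lemma envelope_words:
  assumes "m \<ge> 1"
  shows "envelope \<in> words 2 (2 + (2 * m - 1))"
proof -
  note rank_L = bij_betw_rank_in[OF finite_set[of L] strict_linear_on_less]
  have card: "card (set L) = 2 * m - 1" using distinct_levels length_levels_leaf_meet by (simp add: distinct_card)
  have rank_less: "rank_in (<) (set L) v < 2 * m - 1" if "v \<in> set L" for v
    using rank_L that card by (auto simp: bij_betw_def)
  have rank_ex: "\<exists>v\<in>set L. rank_in (<) (set L) v = j" if "j < 2 * m - 1" for j
    using rank_L that card unfolding bij_betw_def by (metis imageE lessThan_iff)
  let ?V = envelope
  have V0: "?V ! 0 = 0" "?V ! 1 = 1" by (simp_all add: envelope_def)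
  have V2: "?V ! (2 + p) = letter p" if "p \<le> Max (set L)" for p
    using that by (simp add: envelope_def nth_append del: upt_Suc)
  have len: "length ?V = 2 + Suc (Max (set L))" by (simp add: envelope_def)
  have VL: "?V ! (2 + v) = 2 + rank_in (<) (set L) v" "2 + v < length ?V" if "v \<in> set L" for v
    using V2[of v] Max_ge[OF finite_set that] that by (simp_all add: letter_def len le_imp_less_Suc)
  have idx: "p = 0 \<or> p = 1 \<or> (\<exists>p'. p = 2 + p' \<and> p' \<le> Max (set L))" if "p < length ?V" for p
  proof -
    consider "p = 0" | "p = 1" | "p \<ge> 2" by linarith
    then show ?thesis using that len by cases (auto intro!: exI[of _ "p - 2"])
  qed
  have small: "\<exists>i<p. ?V ! i = j" if p: "p < length ?V" "j < ?V ! p" for p j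
  proof -
    consider "p = 0" | "p = 1" | p' where "p = 2 + p'" "p' \<le> Max (set L)" using idx[OF p(1)] by blast
    then show ?thesis
    proof cases
      case 1 then show ?thesis using p V0 by simp
    next
      case 2 then show ?thesis using p V0 by (intro exI[of _ 0]) simp
    next
      case 3
      then have jl: "j < letter p'" using p V2 by simp
      consider "j = 0" | "j = 1" | "j \<ge> 2" by linarith
      then show ?thesis
      proof cases
        case 1 then show ?thesis using V0 3 by (intro exI[of _ 0]) simp
      next
        case 2 then show ?thesis using V0 3 by (intro exI[of _ 1]) simp
      next
        case j2: 3
        then have "letter p' \<ge> 2" using jl by simp
        then obtain v where v: "v \<in> set L" "v \<le> p'" "letter p' = 2 + rank_in (<) (set L) v"
          by (rule letter_cases)
        have "j - 2 < rank_in (<) (set L) v" using jl v(3) j2 by simp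
        then obtain u where u: "u \<in> set L" "rank_in (<) (set L) u = j - 2"
          using rank_ex[of "j - 2"] rank_less[OF v(1)] by auto
        then have "u < v" using \<open>j - 2 < _\<close> v(1) rank_in_less_iff[OF finite_set strict_linear_on_less, of u L v] by simp
        then show ?thesis using VL(1)[OF u(1)] u(2) j2 v(2) \<open>p = 2 + p'\<close> by (intro exI[of _ "2 + u"]) simp
      qed
    qed
  qed
  have set: "set ?V = {..<2 + (2 * m - 1)}"
  proof
    have "letter p < 2 + (2 * m - 1)" for p
    proof (cases "letter p \<ge> 2")
      case True
      then obtain v where "v \<in> set L" "letter p = 2 + rank_in (<) (set L) v" by (rule letter_cases)
      then show ?thesis using rank_less[of v] by simp
    qed simp
    then show "set ?V \<subseteq> {..<2 + (2 * m - 1)}" by (auto simp: envelope_def simp del: upt_Suc)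
    show "{..<2 + (2 * m - 1)} \<subseteq> set ?V"
    proof
      fix j assume j: "j \<in> {..<2 + (2 * m - 1)}"
      consider "j = 0" | "j = 1" | "j \<ge> 2" by linarith
      then show "j \<in> set ?V"
      proof cases
        case 3
        then have "j - 2 < 2 * m - 1" using j unfolding lessThan_iff by linarith
        then obtain v where v: "v \<in> set L" "rank_in (<) (set L) v = j - 2" using rank_ex by blast
        then have "?V ! (2 + v) = j" using VL(1)[OF v(1)] 3 by simp
        then show ?thesis using VL(2)[OF v(1)] by (metis nth_mem)
      qed (simp_all add: envelope_def)
    qed
  qed
  have "?V ! i = i" if "i < 2" for i using that V0 by (cases "i = 0") (auto simp: less_2_cases_iff)
  then show ?thesis unfolding words_def using small set len by auto
qed

text \<open>By the first claim, the leaf parameter of a point marks the end of its code word; by the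
  second, evaluating the letters up to there returns the code word. Off the levels, a cut falls on
  the same side of the point as the meet whose parameter it carries.\<close>

lemma eval_letter_before_leaf:
  assumes i: "i < m" and p: "p < leaf_level (xs ! i)"
  shows "letter p \<noteq> 2 + standardize L ! (2 * i)"
    and "eval_letter (standardize L) i (letter p) = (if cut p (xs ! i) then 1 else 0)"
proof -
  let ?t = "standardize L"
  have m: "m \<ge> 1" using i by simp
  have t: "distinct ?t" "length ?t = 2 * m - 1"
    using standardize_alternating[OF distinct_levels alternating_levels[OF m]] length_levels_leaf_meet
    by (auto simp: alternating_on_def)
  have t_nth: "?t ! j = rank_in (<) (set L) (L ! j)" if "j < 2 * m - 1" for j
    using that length_levels_leaf_meet by (simp add: nth_standardize)
  have inj: "?t ! j = ?t ! k \<longleftrightarrow> j = k" if "j < 2 * m - 1" "k < 2 * m - 1" for j k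
    using t that by (simp add: nth_eq_iff_index_eq)
  have in_take: "?t ! j \<in> set (take (2 * i) ?t) \<longleftrightarrow> j < 2 * i" if "j < 2 * m - 1" for j
    using that i t(2) inj unfolding in_set_conv_nth by auto
  have ev: "eval_letter ?t i (2 + ?t ! j) = (if j < 2 * i then 1 else 0)" if "j < 2 * m - 1" for j
    using in_take[OF that] by (simp add: eval_letter_def)
  have "letter p \<noteq> 2 + ?t ! (2 * i) \<and>
    eval_letter ?t i (letter p) = (if cut p (xs ! i) then 1 else 0)"
  proof (cases "p \<in> set L")
    case True
    then obtain j where j: "j < 2 * m - 1" "p = L ! j" using length_levels_leaf_meet by (auto simp: in_set_conv_nth)
    have lp: "letter p = 2 + ?t ! j" using True j t_nth by (simp add: letter_def)
    have "j \<noteq> 2 * i" using j(2) p levels_leaf[OF i] by auto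
    then show ?thesis unfolding lp ev[OF j(1)] using cut_levels[OF j(1) i] inj[OF j(1), of "2 * i"] i j(2) by simp
  next
    case False
    consider "cut_index p = 0" | "cut_index p = m" "cut_index p \<noteq> 0"
      | "cut_index p \<noteq> 0" "cut_index p < m" using cut_index_le[of p] by linarith
    then show ?thesis
    proof cases
      case 1
      then show ?thesis using False cut_iff_cut_index[OF i] by (simp add: letter_def eval_letter_def)
    next
      case 2
      then show ?thesis using False cut_iff_cut_index[OF i] i by (simp add: letter_def eval_letter_def)
    next
      case 3
      let ?j = "2 * cut_index p - 1"
      have j: "?j < 2 * m - 1" using 3 by simp
      have lp: "letter p = 2 + ?t ! ?j" using False 3 t_nth[OF j] by (simp add: letter_def)
      have "odd ?j" using 3 by simp
      then have "?j \<noteq> 2 * i" by (metis dvd_triv_left)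
      then have "?t ! ?j \<noteq> ?t ! (2 * i)" using inj[OF j, of "2 * i"] i by simp
      moreover have "?j < 2 * i \<longleftrightarrow> cut_index p \<le> i" using 3 by linarith
      ultimately show ?thesis unfolding lp ev[OF j] using cut_iff_cut_index[OF i, of p] by simp
    qed
  qed
  then show "letter p \<noteq> 2 + ?t ! (2 * i)"
    "eval_letter ?t i (letter p) = (if cut p (xs ! i) then 1 else 0)" by blast+
qed

text \<open>Truncation at the leaf parameter and evaluation both commute with substitution into
  \<open>W\<close>. All \<open>m\<close> substituted code words can thus be recovered from
  \<open>act envelope W\<close> and the type, without reference to \<open>xs\<close>.\<close>

lemma eval_envelope:
  assumes i: "i < m" and W: "rigid a W"
  shows "map (eval_letter (standardize L) i)
    (takeWhile (\<lambda>x. x \<noteq> 2 + standardize L ! (2 * i)) (act envelope W)) = act (bits (xs ! i)) W"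
proof -
  let ?t = "standardize L" and ?p = "leaf_level (xs ! i)" and ?M = "Max (set L)"
  let ?V = "[0, 1] @ map letter [0..<?p]"
  have idx: "2 * i < length L" using i length_levels_leaf_meet by simp
  have pL: "?p \<in> set L" using nth_mem[OF idx] levels_leaf[OF i] by simp
  then have "?p \<le> ?M" by simp
  then have "[0..<Suc ?M] = [0..<?p] @ ?p # [Suc ?p..<Suc ?M]"
    by (intro upt_split) simp
  then have env: "envelope = ?V @ letter ?p # map letter [Suc ?p..<Suc ?M]"
    by (simp add: envelope_def del: upt_Suc)
  have lp: "letter ?p = 2 + ?t ! (2 * i)"
    using pL idx levels_leaf[OF i] by (simp add: letter_def nth_standardize)
  obtain s' where s': "act envelope W = act ?V W @ letter ?p # s'"
    using act_append_Cons[OF W, of "map letter [Suc ?p..<Suc ?M]" UNIV "letter ?p" ?V]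
    unfolding env by blast
  have "takeWhile (\<lambda>x. x \<noteq> letter ?p) (act ?V W @ letter ?p # s') = act ?V W"
  proof (subst takeWhile_append2)
    fix x assume "x \<in> set (act ?V W)"
    then have "x \<in> set ?V" using set_act[OF W, of ?V] by simp
    then have "x < 2 \<or> (\<exists>q<?p. x = letter q)" by auto
    moreover have "letter q \<noteq> letter ?p" if "q < ?p" for q
      unfolding lp by (rule eval_letter_before_leaf(1)[OF i that])
    moreover have "2 \<le> letter ?p" by (simp add: lp)
    ultimately show "x \<noteq> letter ?p" by (metis not_le)
  qed simp
  then have "map (eval_letter ?t i) (takeWhile (\<lambda>x. x \<noteq> 2 + ?t ! (2 * i)) (act envelope W)) =
      act (map (eval_letter ?t i) ?V) W"
    by (simp only: s' lp map_act[OF W])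
  also have "map (eval_letter ?t i) ?V = bits (xs ! i)"
    using eval_letter_before_leaf(2)[OF i] by (auto simp: bits_def) (auto simp: eval_letter_def)
  finally show ?thesis .
qed

end

section \<open>From code words back to coloured rationals\<close>

definition rat_interval :: "nat list \<Rightarrow> rat \<times> rat" where
  "rat_interval s = foldl (\<lambda>(l, h) b. if b = 0 then (l, l + (h - l) / 3) else (h - (h - l) / 3, h)) (0, 1) s"

definition coloured_point :: "(rat \<Rightarrow> nat) \<Rightarrow> nat list \<Rightarrow> nat \<Rightarrow> rat" where
  "coloured_point c s i = (SOME x. fst (rat_interval s) < x \<and> x < snd (rat_interval s) \<and> c x = i)"

lemma rat_interval_snoc:
  "rat_interval (s @ [b]) = (case rat_interval s of (l, h) \<Rightarrow>
     if b = 0 then (l, l + (h - l) / 3) else (h - (h - l) / 3, h))"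
  unfolding rat_interval_def foldl_append by (simp split: prod.split)

lemma rat_interval_less: "fst (rat_interval s) < snd (rat_interval s)"
proof (induction s rule: rev_induct)
  case (snoc b s)
  then show ?case by (cases "rat_interval s") (auto simp: rat_interval_snoc field_simps)
qed (simp add: rat_interval_def)

lemma rat_interval_append:
  "fst (rat_interval s) \<le> fst (rat_interval (s @ t)) \<and> snd (rat_interval (s @ t)) \<le> snd (rat_interval s)"
proof (induction t rule: rev_induct)
  case (snoc b t)
  have "fst (rat_interval (s @ t)) \<le> fst (rat_interval ((s @ t) @ [b])) \<and>
    snd (rat_interval ((s @ t) @ [b])) \<le> snd (rat_interval (s @ t))"
    using rat_interval_less[of "s @ t"] unfolding rat_interval_snoc
    by (cases "rat_interval (s @ t)") (auto simp: field_simps)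
  with snoc show ?case by (auto simp del: append_assoc simp add: append_assoc[symmetric])
qed simp

text \<open>The intervals form a Cantor scheme; the discarded middle third keeps the two sides of a
  branching apart.\<close>

lemma rat_interval_split:
  assumes "b \<noteq> 0"
  shows "snd (rat_interval (u @ 0 # s)) < fst (rat_interval (u @ b # t))"
proof -
  have "snd (rat_interval ((u @ [0]) @ s)) \<le> snd (rat_interval (u @ [0]))"
    using rat_interval_append by blast
  also have "\<dots> < fst (rat_interval (u @ [b]))"
    using rat_interval_less[of u] assms unfolding rat_interval_snoc
    by (cases "rat_interval u") (simp add: field_simps)
  also have "\<dots> \<le> fst (rat_interval ((u @ [b]) @ t))"
    using rat_interval_append by blast
  finally show ?thesis by simp
qed

lemma coloured_point:
  assumes "dense_colouring n c" "i < n"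
  shows "fst (rat_interval s) < coloured_point c s i" "coloured_point c s i < snd (rat_interval s)"
    "c (coloured_point c s i) = i"
proof -
  have "\<exists>x. fst (rat_interval s) < x \<and> x < snd (rat_interval s) \<and> c x = i"
    using assms rat_interval_less[of s] unfolding dense_colouring_def by blast
  from someI_ex[OF this] show "fst (rat_interval s) < coloured_point c s i"
    "coloured_point c s i < snd (rat_interval s)" "c (coloured_point c s i) = i"
    unfolding coloured_point_def by blast+
qed

text \<open>The meet of two rationals precedes both levels, so their code words branch, 0 on the
  left and 1 on the right. Substitution into \<open>W\<close> preserves the branching, and the
  points lie in disjoint intervals whatever their colours.\<close>

lemma coloured_point_act_bits_less:
  assumes c: "dense_colouring n c" "i < n" "j < n" and W: "rigid a W" and xy: "x < y"
  shows "coloured_point c (act (bits x) W) i < coloured_point c (act (bits y) W) j"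
proof -
  let ?u = "[0, 1] @ map (\<lambda>p. if cut p x then 1 else 0) [0..<meet_level x y]"
  let ?p = "meet_level x y"
  have bx: "bits x = ?u @ 0 # map (\<lambda>p. if cut p x then 1 else 0) [Suc ?p..<leaf_level x]"
    using upt_split[OF meet_level_less_leaf(1)[OF xy]] meet_level_cut[OF xy] by (simp add: bits_def)
  have "map (\<lambda>p. if cut p y then 1 else 0) [0..<?p] = map (\<lambda>p. if cut p x then 1 else (0::nat)) [0..<?p]"
    using cut_before_meet[OF xy] by simp
  then have "by": "bits y = ?u @ 1 # map (\<lambda>p. if cut p y then 1 else 0) [Suc ?p..<leaf_level y]"
    using upt_split[OF meet_level_less_leaf(2)[OF xy]] meet_level_cut[OF xy] by (simp add: bits_def)
  obtain s t where "act (bits x) W = act ?u W @ 0 # s" "act (bits y) W = act ?u W @ 1 # t"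
    using act_append_Cons[OF W, of _ UNIV _ ?u] unfolding bx "by" by blast
  then have "snd (rat_interval (act (bits x) W)) < fst (rat_interval (act (bits y) W))"
    using rat_interval_split[of 1] by simp
  then show ?thesis
    using coloured_point(2)[OF c(1,2), of "act (bits x) W"] coloured_point(1)[OF c(1,3), of "act (bits y) W"]
    by simp
qed

text \<open>A single colouring treats all types: a word \<open>U\<close> receives the function that
  sends each type to the colour of the set decoded from \<open>U\<close> with it. Constancy on the
  substituted envelopes leaves at most one colour per type.\<close>

theorem big_ramsey_upper_bound:
  assumes c: "dense_colouring n c" and P: "in_P n A lt col" and A: "A \<noteq> {}"
  shows "big_ramsey_bound c A lt col (card (alternating_on {..<2 * card A - 1}))"
  unfolding big_ramsey_bound_def
proof (intro allI impI)
  fix k :: nat and chi :: "rat set \<Rightarrow> nat"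
  assume chi: "\<forall>S\<in>copies c A lt col. chi S < k"
  define m where "m = card A"
  have A': "finite A" "strict_linear_on A lt" using P by (auto simp: in_P_def)
  \<comment> \<open>For empty \<open>A\<close> there would be no types at all, although the empty
    set is a copy and receives a colour.\<close>
  have m: "m \<ge> 1" using A A' by (simp add: m_def Suc_le_eq card_gt_0_iff)
  let ?N = "2 * m - 1"
  let ?col = "pattern_colour A lt col"
  define node where "node t U i = map (eval_letter t i) (takeWhile (\<lambda>x. x \<noteq> 2 + t ! (2 * i)) U)"
    for t and U :: "nat list" and i
  \<comment> \<open>Decoding an arbitrary word need not give a copy, and there \<open>chi\<close> is
    unbounded; \<open>min k\<close> makes the range finite and changes nothing on copies.\<close>
  define \<phi> where "\<phi> U = (\<lambda>t\<in>alternating_on {..<?N}.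
    min k (chi ((\<lambda>i. coloured_point c (node t U i) (?col i)) ` {..<m})))" for U
  have "range \<phi> \<subseteq> PiE (alternating_on {..<?N}) (\<lambda>_. {..k})" by (auto simp: \<phi>_def)
  then have "finite (range \<phi>)"
    by (rule finite_subset) (intro finite_PiE finite_alternating_on finite_lessThan finite_atMost)
  then have "\<exists>W F. rigid 2 W \<and> (\<forall>V\<in>words 2 (2 + ?N). \<phi> (act V W) = F)"
    by (intro Carlson_Simpson) simp_all
  then obtain W F where W: "rigid 2 W" "\<And>V. V \<in> words 2 (2 + ?N) \<Longrightarrow> \<phi> (act V W) = F" by blast
  have cn: "c x < n" for x using c by (simp add: dense_colouring_def)
  define f where "f x = coloured_point c (act (bits x) W) (c x)" for x
  have mono: "strict_mono f"
    unfolding f_def by (rule strict_monoI) (rule coloured_point_act_bits_less[OF c cn cn W(1)])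
  have cf: "c (f x) = c x" for x unfolding f_def by (rule coloured_point(3)[OF c cn])
  have "range f \<in> self_copies c"
    unfolding self_copies_def using mono cf
    by (auto intro!: exI[of _ f] simp: bij_betw_def strict_mono_imp_inj_on)
  moreover have "chi S \<in> F ` alternating_on {..<?N}" if S: "S \<in> copies c A lt col" "S \<subseteq> range f" for S
  proof -
    obtain ys where ys: "sorted_wrt (<) ys" "set ys = S" "length ys = m" "\<forall>i<m. c (ys ! i) = ?col i"
      using S(1) copies_iff[OF A'] by (auto simp: m_def)
    define xs where "xs = map (inv f) ys"
    have fxs: "f (xs ! i) = ys ! i" if "i < m" for i
    proof -
      have "ys ! i \<in> range f" using that ys S(2) by (metis nth_mem subsetD)
      then show ?thesis using that ys(3) by (simp add: xs_def f_inv_into_f)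
    qed
    have len: "length xs = m" using ys by (simp add: xs_def)
    have sorted: "sorted_wrt (<) xs"
      unfolding sorted_wrt_iff_nth_less
    proof (intro allI impI)
      fix i j assume ij: "i < j" "j < length xs"
      then have "f (xs ! i) < f (xs ! j)" using fxs len ys(1,3) by (simp add: sorted_wrt_iff_nth_less)
      then show "xs ! i < xs ! j" using mono by (simp add: strict_mono_less)
    qed
    define L where "L = levels leaf_level meet_level xs"
    define t where "t = standardize L"
    define V where "V = envelope xs L m"
    have t: "t \<in> alternating_on {..<?N}"
      using standardize_alternating[OF distinct_levels[OF sorted len L_def] alternating_levels[OF sorted len L_def m]]
      by (simp add: t_def L_def len)
    have V: "V \<in> words 2 (2 + ?N)" unfolding V_def by (rule envelope_words[OF sorted len L_def m])
    have "coloured_point c (node t (act V W) i) (?col i) = ys ! i" if i: "i < m" for i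
    proof -
      have "node t (act V W) i = act (bits (xs ! i)) W"
        unfolding node_def t_def V_def by (rule eval_envelope[OF sorted len L_def i W(1)])
      moreover have "?col i = c (xs ! i)" using ys(4) i fxs[OF i] cf[of "xs ! i"] by simp
      ultimately show ?thesis using fxs[OF i] by (simp add: f_def)
    qed
    then have "(\<lambda>i. coloured_point c (node t (act V W) i) (?col i)) ` {..<m} = (!) ys ` {..<m}"
      by simp
    also have "\<dots> = S" using ys by (auto simp: set_conv_nth)
    finally have "\<phi> (act V W) t = min k (chi S)" using t by (simp add: \<phi>_def)
    also have "\<dots> = chi S" using bspec[OF chi S(1)] by simp
    finally show ?thesis using W(2)[OF V] t by (metis image_eqI)
  qed
  then have "card (chi ` {S \<in> copies c A lt col. S \<subseteq> range f}) \<le> card (F ` alternating_on {..<?N})"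
    by (intro card_mono finite_imageI finite_alternating_on) auto
  then have "card (chi ` {S \<in> copies c A lt col. S \<subseteq> range f}) \<le> card (alternating_on {..<?N})"
    using card_image_le[OF finite_alternating_on[of "{..<?N}"], of F] by simp
  ultimately show "\<exists>Q\<in>self_copies c. card (chi ` {S \<in> copies c A lt col. S \<subseteq> Q})
      \<le> card (alternating_on {..<2 * card A - 1})"
    unfolding m_def by blast
qed

section \<open>The lower bound\<close>

definition first_between :: "rat \<Rightarrow> rat \<Rightarrow> nat" where
  "first_between x y = (LEAST v. \<exists>z. x \<le> z \<and> z \<le> y \<and> to_nat z = v)"

text \<open>Serves to keep rationals with small codes out of the hull of the image. For one point
  \<open>w\<close>, pick \<open>p < q\<close> inside the interval: \<open>w\<close> cannot be both
  at most \<open>f p\<close> and at least \<open>f q\<close>, so the part above \<open>q\<close> or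
  the part below \<open>p\<close> avoids it.\<close>

lemma shrink_interval_avoiding:
  fixes f :: "rat \<Rightarrow> rat"
  assumes "strict_mono f" "finite F" "a < b"
  shows "\<exists>a' b'. a \<le> a' \<and> a' < b' \<and> b' \<le> b \<and> (\<forall>w\<in>F. \<not> (f a' \<le> w \<and> w \<le> f b'))"
  using assms(2)
proof (induction F)
  case empty
  then show ?case using assms(3) by auto
next
  case (insert w F)
  then obtain a' b' where ab: "a \<le> a'" "a' < b'" "b' \<le> b" "\<forall>w\<in>F. \<not> (f a' \<le> w \<and> w \<le> f b')" by blast
  obtain p where p: "a' < p" "p < b'" using ab(2) dense by blast
  obtain q where q: "p < q" "q < b'" using p(2) dense by blast
  note le = strict_mono_less_eq[OF assms(1)] strict_mono_less[OF assms(1)]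
  show ?case
  proof (cases "w \<le> f p")
    case True
    then have "\<not> f q \<le> w" using q le by (meson not_le order_le_less_trans)
    moreover have "f a' \<le> f q" using p q le by simp
    ultimately show ?thesis using ab p q by (intro exI[of _ q] exI[of _ b']) (auto dest: order_trans)
  next
    case False
    moreover have "f p \<le> f b'" using p le by simp
    ultimately show ?thesis using ab p by (intro exI[of _ a'] exI[of _ p]) (auto dest: order_trans)
  qed
qed

lemma infinite_colour_class:
  assumes c: "dense_colouring n c" and i: "i < n" and ab: "a < b"
  shows "infinite {x. a < x \<and> x < b \<and> c x = i}"
proof
  let ?X = "{x. a < x \<and> x < b \<and> c x = i}"
  assume fin: "finite ?X"
  have ex: "\<exists>x. a < x \<and> x < b' \<and> c x = i" if "a < b'" for b'
    using c i that unfolding dense_colouring_def by blast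
  then have ne: "?X \<noteq> {}" using ab by blast
  have "Min ?X \<in> ?X" by (rule Min_in[OF fin ne])
  then obtain x where x: "a < x" "x < Min ?X" "c x = i" "Min ?X < b" using ex[of "Min ?X"] by auto
  then have "x \<in> ?X" by simp
  then show False using Min_le[OF fin] x(2) by (meson not_le)
qed

lemma finite_small_codes: "finite {x :: 'a::countable. to_nat x < K}"
  by (rule finite_imageD[of to_nat]) (auto intro: finite_subset[of _ "{..<K}"] inj_onI)

text \<open>The values of the pattern \<open>t\<close> are realised in increasing order.  A leaf whose value is not yet
  realised is confined to an open interval \<open>J i\<close>; neighbouring leaves share their interval until the
  value of their meet is realised by the first rational in the hull of the image of the interval.\<close>

definition partial_realisation ::
  "(rat \<Rightarrow> nat) \<Rightarrow> (rat \<Rightarrow> rat) \<Rightarrow> (nat \<Rightarrow> nat) \<Rightarrow> nat \<Rightarrow> nat list \<Rightarrow> nat \<Rightarrow> (nat \<Rightarrow> rat set) \<Rightarrow> (nat \<Rightarrow> nat) \<Rightarrow> bool"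
where
  "partial_realisation c f pc m t s J v \<longleftrightarrow>
     strict_mono_on {..<s} v \<and>
     (\<forall>i<m. s \<le> t ! (2 * i) \<longrightarrow> (\<exists>a b. a < b \<and> J i = {a<..<b})) \<and>
     (\<forall>i<m. t ! (2 * i) < s \<longrightarrow> (\<exists>x. J i = {x} \<and> c x = pc i \<and> to_nat (f x) = v (t ! (2 * i)))) \<and>
     (\<forall>i. Suc i < m \<longrightarrow> s \<le> t ! Suc (2 * i) \<longrightarrow> J i = J (Suc i)) \<and>
     (\<forall>i. Suc i < m \<longrightarrow> t ! Suc (2 * i) < s \<longrightarrow> (\<exists>z. to_nat z = v (t ! Suc (2 * i)) \<and>
        (\<forall>x\<in>J i. \<forall>y\<in>J (Suc i). f x < z \<and> z < f y \<and> (\<forall>w. f x \<le> w \<and> w \<le> f y \<longrightarrow> to_nat z \<le> to_nat w))))"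

lemma partial_realisation_step:
  assumes c: "dense_colouring n c" and f: "strict_mono f" and pc: "\<And>i. i < m \<Longrightarrow> pc i < n"
    and t: "t \<in> alternating_on {..<2 * m - 1}" and s: "s < 2 * m - 1"
    and PR: "partial_realisation c f pc m t s J v"
  shows "\<exists>J' v'. partial_realisation c f pc m t (Suc s) J' v'"
proof -
  have len: "length t = 2 * m - 1" and dist: "distinct t" and alt: "alternating t" and sett: "set t = {..<2 * m - 1}"
    using t distinct_card[of t] by (auto simp: alternating_on_def)
  have inj: "t ! j = t ! k \<longleftrightarrow> j = k" if "j < 2 * m - 1" "k < 2 * m - 1" for j k
    using dist len that by (simp add: nth_eq_iff_index_eq)
  have valley: "t ! Suc (2 * i) < t ! (2 * i)" "t ! Suc (2 * i) < t ! (2 * Suc i)" if "Suc i < m" for i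
  proof -
    have "Suc (2 * i) < length t" "Suc (Suc (2 * i)) < length t" using that len by auto
    then show "t ! Suc (2 * i) < t ! (2 * i)" "t ! Suc (2 * i) < t ! (2 * Suc i)"
      using alt unfolding alternating_def by (fastforce dest: spec[of _ "2 * i"] spec[of _ "Suc (2 * i)"])+
  qed
  have PR1: "strict_mono_on {..<s} v"
    and PR2: "\<And>i. i < m \<Longrightarrow> s \<le> t ! (2 * i) \<Longrightarrow> \<exists>a b. a < b \<and> J i = {a<..<b}"
    and PR3: "\<And>i. i < m \<Longrightarrow> t ! (2 * i) < s \<Longrightarrow> \<exists>x. J i = {x} \<and> c x = pc i \<and> to_nat (f x) = v (t ! (2 * i))"
    and PR4: "\<And>i. Suc i < m \<Longrightarrow> s \<le> t ! Suc (2 * i) \<Longrightarrow> J i = J (Suc i)"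
    and PR5: "\<And>i. Suc i < m \<Longrightarrow> t ! Suc (2 * i) < s \<Longrightarrow> \<exists>z. to_nat z = v (t ! Suc (2 * i)) \<and>
        (\<forall>x\<in>J i. \<forall>y\<in>J (Suc i). f x < z \<and> z < f y \<and> (\<forall>w. f x \<le> w \<and> w \<le> f y \<longrightarrow> to_nat z \<le> to_nat w))"
    using PR unfolding partial_realisation_def by simp_all
  \<comment> \<open>All values used so far are below \<open>K\<close>. A new value of at least
    \<open>K\<close> keeps \<open>v\<close> increasing; for a leaf it exists because a colour class
    is infinite in every interval.\<close>
  obtain K where K: "\<forall>k\<in>v ` {..<s}. k < K"
    using finite_nat_set_iff_bounded[of "v ` {..<s}"] by auto
  have mono': "strict_mono_on {..<Suc s} (v(s := w))" if "K \<le> w" for w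
  proof (rule strict_mono_onI)
    fix p q assume pq: "p \<in> {..<Suc s}" "q \<in> {..<Suc s}" "p < q"
    show "(v(s := w)) p < (v(s := w)) q"
    proof (cases "q = s")
      case True
      then have "v p < K" using K pq by simp
      then show ?thesis using True pq that by simp
    next
      case False
      then show ?thesis using pq strict_mono_onD[OF PR1, of p q] by simp
    qed
  qed
  have keep5: "\<exists>z. to_nat z = (v(s := w)) (t ! Suc (2 * i)) \<and>
        (\<forall>x\<in>J' i. \<forall>y\<in>J' (Suc i). f x < z \<and> z < f y \<and> (\<forall>w. f x \<le> w \<and> w \<le> f y \<longrightarrow> to_nat z \<le> to_nat w))"
    if "Suc i < m" "t ! Suc (2 * i) < s" "\<And>k. J' k \<subseteq> J k" for J' i w
    using PR5[OF that(1,2)] that(2,3) by (elim exE conjE, intro exI conjI) (auto, blast+)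
  have "s \<in> set t" using s sett by simp
  then obtain j where j: "j < 2 * m - 1" "t ! j = s" using len by (metis in_set_conv_nth)
  from j(1) show ?thesis
  proof (cases rule: levels_index_cases)
    case (1 i)
    have ts: "t ! (2 * i) = s" using 1 j by simp
    obtain a b where ab: "a < b" "J i = {a<..<b}" using PR2[OF 1(1)] ts by auto
    have "finite {x. to_nat (f x) < K}"
      using finite_vimageI[OF finite_small_codes strict_mono_imp_inj_on[OF f]] by (simp add: vimage_def)
    then have "infinite ({x. a < x \<and> x < b \<and> c x = pc i} - {x. to_nat (f x) < K})"
      using infinite_colour_class[OF c pc[OF 1(1)] ab(1)] by (rule Diff_infinite_finite)
    then have "{x. a < x \<and> x < b \<and> c x = pc i} - {x. to_nat (f x) < K} \<noteq> {}"
      by (rule infinite_imp_nonempty)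
    then obtain x where "x \<in> {x. a < x \<and> x < b \<and> c x = pc i} - {x. to_nat (f x) < K}" by blast
    then have x: "a < x" "x < b" "c x = pc i" "K \<le> to_nat (f x)" by simp_all
    define J' where "J' = J(i := {x})"
    define v' where "v' = v(s := to_nat (f x))"
    have sub: "J' k \<subseteq> J k" for k using x ab by (auto simp: J'_def)
    have "partial_realisation c f pc m t (Suc s) J' v'"
      unfolding partial_realisation_def
    proof (intro conjI allI impI)
      show "strict_mono_on {..<Suc s} v'" unfolding v'_def by (rule mono'[OF x(4)])
    next
      fix k assume "k < m" "Suc s \<le> t ! (2 * k)"
      then show "\<exists>a b. a < b \<and> J' k = {a<..<b}" using PR2[of k] ts by (auto simp: J'_def)
    next
      fix k assume k: "k < m" "t ! (2 * k) < Suc s"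
      show "\<exists>x. J' k = {x} \<and> c x = pc k \<and> to_nat (f x) = v' (t ! (2 * k))"
      proof (cases "k = i")
        case True
        then show ?thesis using x ts by (simp add: J'_def v'_def)
      next
        case False
        then have "t ! (2 * k) \<noteq> s" using ts inj[of "2 * k" "2 * i"] k 1 by simp
        then show ?thesis using PR3[of k] k False by (simp add: J'_def v'_def)
      qed
    next
      fix k assume k: "Suc k < m" "Suc s \<le> t ! Suc (2 * k)"
      \<comment> \<open>A meet has a smaller value than its two leaves, so when leaf
        \<open>i\<close> is realised it is already separated from its neighbours and shares its
        interval with none of them.\<close>
      then have "k \<noteq> i" "Suc k \<noteq> i" using valley[of k] ts by auto
      then show "J' k = J' (Suc k)" using PR4[of k] k by (simp add: J'_def)
    next
      fix k assume k: "Suc k < m" "t ! Suc (2 * k) < Suc s"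
      have "Suc (2 * k) \<noteq> 2 * i" by presburger
      then have "t ! Suc (2 * k) \<noteq> s" using ts inj[of "Suc (2 * k)" "2 * i"] k 1 by simp
      then show "\<exists>z. to_nat z = v' (t ! Suc (2 * k)) \<and>
        (\<forall>x\<in>J' k. \<forall>y\<in>J' (Suc k). f x < z \<and> z < f y \<and> (\<forall>w. f x \<le> w \<and> w \<le> f y \<longrightarrow> to_nat z \<le> to_nat w))"
        unfolding v'_def using k sub by (intro keep5) auto
    qed
    then show ?thesis by blast
  next
    case (2 i)
    have ts: "t ! Suc (2 * i) = s" using 2 j by simp
    have gt: "s < t ! (2 * i)" "s < t ! (2 * Suc i)" using valley[OF 2(1)] ts by auto
    obtain a b where ab: "a < b" "J i = {a<..<b}" using PR2[of i] 2 gt by auto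
    have Jeq: "J (Suc i) = J i" using PR4[OF 2(1)] ts by simp
    \<comment> \<open>After this shrinking, every rational in the hull of the image has a code of at
      least \<open>K\<close>, in particular the one with the least code.\<close>
    obtain a' b' where ab': "a \<le> a'" "a' < b'" "b' \<le> b"
      "\<forall>w\<in>{w. to_nat w < K}. \<not> (f a' \<le> w \<and> w \<le> f b')"
      using shrink_interval_avoiding[OF f finite_small_codes ab(1)] by blast
    define in_hull where "in_hull z \<longleftrightarrow> (\<exists>x y. a' < x \<and> y < b' \<and> x < b' \<and> a' < y \<and> f x \<le> z \<and> z \<le> f y)" for z
    obtain q where "a' < q" "q < b'" using ab'(2) dense by blast
    then have "in_hull (f q)" by (auto simp: in_hull_def)
    then obtain z where z: "in_hull z" "\<And>w. in_hull w \<Longrightarrow> to_nat z \<le> to_nat w"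
      using ex_has_least_nat[of in_hull _ to_nat] by blast
    \<comment> \<open>The images of \<open>p\<close> and \<open>q\<close> enclose \<open>z\<close>,
      so images of points below \<open>p\<close> lie strictly below \<open>z\<close> and those of
      points above \<open>q\<close> strictly above it.\<close>
    obtain p q where pq: "a' < p" "p < b'" "a' < q" "q < b'" "f p \<le> z" "z \<le> f q"
      using z(1) by (auto simp: in_hull_def)
    note less = strict_mono_less[OF f]
    have "f a' \<le> z" "z \<le> f b'" using pq less by (meson less_imp_le order_trans)+
    then have zK: "K \<le> to_nat z" using ab'(4) by (metis mem_Collect_eq not_le)
    \<comment> \<open>All unrealised leaves sharing the interval of leaf \<open>i\<close> move
      along, to the side determined by their index. Neighbours other than \<open>i\<close> and
      \<open>Suc i\<close> go to the same side and continue to share an interval.\<close>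
    define J' where "J' k = (if J k = J i \<and> s \<le> t ! (2 * k) then (if k \<le> i then {a'<..<p} else {q<..<b'}) else J k)" for k
    define v' where "v' = v(s := to_nat z)"
    have sub: "J' k \<subseteq> J k" for k using ab ab' pq by (auto simp: J'_def)
    have J'i: "J' i = {a'<..<p}" "J' (Suc i) = {q<..<b'}" using gt Jeq by (auto simp: J'_def)
    have "partial_realisation c f pc m t (Suc s) J' v'"
      unfolding partial_realisation_def
    proof (intro conjI allI impI)
      show "strict_mono_on {..<Suc s} v'" unfolding v'_def by (rule mono'[OF zK])
    next
      fix k assume "k < m" "Suc s \<le> t ! (2 * k)"
      then obtain a b where "a < b" "J k = {a<..<b}" using PR2[of k] by auto
      moreover have "J' k = {a'<..<p} \<or> J' k = {q<..<b'} \<or> J' k = J k" by (simp add: J'_def)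
      ultimately show "\<exists>a b. a < b \<and> J' k = {a<..<b}" using pq by metis
    next
      fix k assume k: "k < m" "t ! (2 * k) < Suc s"
      have "2 * k \<noteq> Suc (2 * i)" by presburger
      then have "t ! (2 * k) \<noteq> s" using ts inj[of "2 * k" "Suc (2 * i)"] k 2 by simp
      then show "\<exists>x. J' k = {x} \<and> c x = pc k \<and> to_nat (f x) = v' (t ! (2 * k))"
        using PR3[of k] k by (simp add: J'_def v'_def)
    next
      fix k assume k: "Suc k < m" "Suc s \<le> t ! Suc (2 * k)"
      then have "k \<noteq> i" using ts by auto
      moreover have "J k = J (Suc k)" using PR4[of k] k by simp
      moreover have "s \<le> t ! (2 * k)" "s \<le> t ! (2 * Suc k)" using valley[of k] k by simp_all
      ultimately show "J' k = J' (Suc k)" by (simp add: J'_def)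
    next
      fix k assume k: "Suc k < m" "t ! Suc (2 * k) < Suc s"
      show "\<exists>z. to_nat z = v' (t ! Suc (2 * k)) \<and>
        (\<forall>x\<in>J' k. \<forall>y\<in>J' (Suc k). f x < z \<and> z < f y \<and> (\<forall>w. f x \<le> w \<and> w \<le> f y \<longrightarrow> to_nat z \<le> to_nat w))"
      proof (cases "k = i")
        case True
        have "f x < z \<and> z < f y \<and> (\<forall>w. f x \<le> w \<and> w \<le> f y \<longrightarrow> to_nat z \<le> to_nat w)"
          if xy: "x \<in> J' i" "y \<in> J' (Suc i)" for x y
        proof (intro conjI allI impI)
          have x: "a' < x" "x < p" and y: "q < y" "y < b'" using xy J'i by auto
          show "f x < z" using x(2) pq(5) less by (meson order_less_le_trans)
          show "z < f y" using y(1) pq(6) less by (meson order_le_less_trans)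
          fix w assume "f x \<le> w \<and> w \<le> f y"
          then have "in_hull w" unfolding in_hull_def using x y pq by (intro exI[of _ x] exI[of _ y]) auto
          then show "to_nat z \<le> to_nat w" by (rule z(2))
        qed
        then show ?thesis using True ts by (intro exI[of _ z]) (simp add: v'_def)
      next
        case False
        then have "t ! Suc (2 * k) \<noteq> s" using ts inj[of "Suc (2 * k)" "Suc (2 * i)"] k 2 by simp
        then show ?thesis unfolding v'_def using k sub by (intro keep5) auto
      qed
    qed
    then show ?thesis by blast
  qed
qed

lemma pattern_realised:
  assumes c: "dense_colouring n c" and f: "strict_mono f" and pc: "\<And>i. i < m \<Longrightarrow> pc i < n"
    and t: "t \<in> alternating_on {..<2 * m - 1}"
  shows "\<exists>xs. length xs = m \<and> sorted_wrt (<) xs \<and> (\<forall>i<m. c (xs ! i) = pc i) \<and>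
    standardize (levels to_nat first_between (map f xs)) = t"
proof -
  have len: "length t = 2 * m - 1" and sett: "set t = {..<2 * m - 1}"
    using t distinct_card[of t] by (auto simp: alternating_on_def)
  have "\<exists>J v. partial_realisation c f pc m t s J v" if "s \<le> 2 * m - 1" for s
    using that
  proof (induction s)
    case 0
    have "\<exists>a b :: rat. a < b \<and> {0<..<1} = {a<..<b}" by (intro exI[of _ 0] exI[of _ 1]) simp
    then have "partial_realisation c f pc m t 0 (\<lambda>_. {0<..<1}) (\<lambda>_. 0)"
      by (simp add: partial_realisation_def strict_mono_on_def)
    then show ?case by blast
  next
    case (Suc s)
    then show ?case using partial_realisation_step[OF c f pc t, where s = s] by auto
  qed
  then obtain J v where PR: "partial_realisation c f pc m t (2 * m - 1) J v" by blast
  have less: "t ! j < 2 * m - 1" if "j < 2 * m - 1" for j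
    using that len sett nth_mem[of j t] by auto
  have "\<exists>x. J i = {x} \<and> c x = pc i \<and> to_nat (f x) = v (t ! (2 * i))" if "i < m" for i
    using PR that less[of "2 * i"] unfolding partial_realisation_def by simp
  then obtain x where x: "\<And>i. i < m \<Longrightarrow> J i = {x i} \<and> c (x i) = pc i \<and> to_nat (f (x i)) = v (t ! (2 * i))"
    by metis
  have meet: "\<exists>z. to_nat z = v (t ! Suc (2 * i)) \<and> f (x i) < z \<and> z < f (x (Suc i)) \<and>
      (\<forall>w. f (x i) \<le> w \<and> w \<le> f (x (Suc i)) \<longrightarrow> to_nat z \<le> to_nat w)" if i: "Suc i < m" for i
  proof -
    have "\<exists>z. to_nat z = v (t ! Suc (2 * i)) \<and>
      (\<forall>x\<in>J i. \<forall>y\<in>J (Suc i). f x < z \<and> z < f y \<and> (\<forall>w. f x \<le> w \<and> w \<le> f y \<longrightarrow> to_nat z \<le> to_nat w))"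
      using PR i less[of "Suc (2 * i)"] unfolding partial_realisation_def by simp
    then show ?thesis using x[of i] x[of "Suc i"] i by auto
  qed
  have first: "first_between (f (x i)) (f (x (Suc i))) = v (t ! Suc (2 * i))" if i: "Suc i < m" for i
  proof -
    obtain z where z: "to_nat z = v (t ! Suc (2 * i))" "f (x i) < z" "z < f (x (Suc i))"
      "\<forall>w. f (x i) \<le> w \<and> w \<le> f (x (Suc i)) \<longrightarrow> to_nat z \<le> to_nat w" using meet[OF i] by blast
    show ?thesis unfolding first_between_def
    proof (rule Least_equality)
      show "\<exists>z. f (x i) \<le> z \<and> z \<le> f (x (Suc i)) \<and> to_nat z = v (t ! Suc (2 * i))"
        using z by (intro exI[of _ z]) simp
      show "v (t ! Suc (2 * i)) \<le> y" if "\<exists>z. f (x i) \<le> z \<and> z \<le> f (x (Suc i)) \<and> to_nat z = y" for y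
        using that z by auto
    qed
  qed
  let ?xs = "map x [0..<m]"
  have step: "x i < x (Suc i)" if "Suc i < m" for i
    using meet[OF that] f by (meson less_trans strict_mono_less)
  have "sorted_wrt (<) ?xs"
    unfolding sorted_wrt_iff_nth_Suc_transp[OF transp_on_less] using step by simp
  moreover have "levels to_nat first_between (map f ?xs) = map v t"
  proof (rule nth_equalityI)
    show "length (levels to_nat first_between (map f ?xs)) = length (map v t)" by (simp add: len)
    fix j assume "j < length (levels to_nat first_between (map f ?xs))"
    then have j: "j < 2 * m - 1" by simp
    then show "levels to_nat first_between (map f ?xs) ! j = map v t ! j"
    proof (cases rule: levels_index_cases)
      case (1 i)
      then show ?thesis using nth_levels_even[of i "map f ?xs"] x[of i] j len by simp
    next
      case (2 i)
      then show ?thesis using nth_levels_odd[of i "map f ?xs"] first[of i] j len by simp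
    qed
  qed
  moreover have "strict_mono_on {..<2 * m - 1} v" using PR by (simp add: partial_realisation_def)
  ultimately show ?thesis using x standardize_map_strict_mono[OF sett]
    by (intro exI[of _ ?xs]) simp
qed

theorem big_ramsey_lower_bound:
  assumes c: "dense_colouring n c" and P: "in_P n A lt col"
    and bound: "big_ramsey_bound c A lt col L"
  shows "card (alternating_on {..<2 * card A - 1}) \<le> L"
proof -
  define m where "m = card A"
  let ?N = "2 * m - 1"
  have A': "finite A" "strict_linear_on A lt" using P by (auto simp: in_P_def)
  let ?pat = "\<lambda>S. standardize (levels to_nat first_between (sorted_list_of_set S))"
  define chi :: "rat set \<Rightarrow> nat" where "chi S = to_nat (?pat S)" for S
  \<comment> \<open>\<open>chi\<close> has to be bounded on all copies, including those whose levels
    repeat and whose pattern is not alternating; hence this crude finite set of lists.\<close>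
  have pat: "?pat S \<in> {xs. set xs \<subseteq> {..?N} \<and> length xs = ?N}" if S: "S \<in> copies c A lt col" for S
  proof -
    obtain ys where ys: "sorted_wrt (<) ys" "set ys = S" "length ys = m"
      using S[unfolded copies_iff[OF A']] unfolding m_def by blast
    then have "card S = m" using strict_sorted_iff distinct_card by metis
    then have len: "length (levels to_nat first_between (sorted_list_of_set S)) = ?N" by simp
    let ?L = "levels to_nat first_between (sorted_list_of_set S)"
    have "rank_in (<) (set ?L) x \<le> ?N" for x
      unfolding rank_in_def len[symmetric]
      by (rule order_trans[OF card_mono[of "set ?L"] card_length]) auto
    then have "set (standardize ?L) \<subseteq> {..?N}" by (auto simp only: standardize_def set_map atMost_iff)
    then show ?thesis using len by (simp only: mem_Collect_eq length_standardize)
  qed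
  have fin: "finite {xs. set xs \<subseteq> {..?N} \<and> length xs = ?N}" by (rule finite_lists_length_eq) simp
  then obtain k where k: "\<forall>v\<in>to_nat ` {xs. set xs \<subseteq> {..?N} \<and> length xs = ?N}. v < k"
    using finite_nat_set_iff_bounded[of "to_nat ` {xs. set xs \<subseteq> {..?N} \<and> length xs = ?N}"] by auto
  have chik: "chi S < Suc k" if "S \<in> copies c A lt col" for S
    using k pat[OF that] unfolding chi_def by (meson image_eqI less_Suc_eq)
  obtain Q where Q: "Q \<in> self_copies c" "card (chi ` {S \<in> copies c A lt col. S \<subseteq> Q}) \<le> L"
    using bound chik unfolding big_ramsey_bound_def by (metis zero_less_Suc)
  obtain f where f: "bij_betw f UNIV Q" "strict_mono f" "\<And>x. c (f x) = c x"
    using Q(1) by (auto simp: self_copies_def)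
  have "to_nat ` alternating_on {..<?N} \<subseteq> chi ` {S \<in> copies c A lt col. S \<subseteq> Q}"
  proof
    fix w assume "w \<in> to_nat ` (alternating_on {..<?N} :: nat list set)"
    then obtain t where t: "t \<in> alternating_on {..<?N}" "w = to_nat t" by blast
    have "\<exists>xs. length xs = m \<and> sorted_wrt (<) xs \<and> (\<forall>i<m. c (xs ! i) = pattern_colour A lt col i) \<and>
        standardize (levels to_nat first_between (map f xs)) = t"
      by (rule pattern_realised[OF c f(2) _ t(1)]) (simp add: m_def pattern_colour_less[OF P])
    then obtain xs where xs: "length xs = m" "sorted_wrt (<) xs" "\<forall>i<m. c (xs ! i) = pattern_colour A lt col i"
      "standardize (levels to_nat first_between (map f xs)) = t" by blast
    have sorted: "sorted_wrt (<) (map f xs)"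
      using xs(2) f(2) by (simp add: sorted_wrt_map strict_mono_less)
    let ?S = "set (map f xs)"
    have "?S \<in> copies c A lt col"
      unfolding copies_iff[OF A'] using sorted xs f(3) by (intro exI[of _ "map f xs"]) (simp add: m_def)
    moreover have "?S \<subseteq> Q" using f(1) by (auto simp: bij_betw_def)
    moreover have "sorted_list_of_set ?S = map f xs"
      using sorted by (metis strict_sorted_iff sorted_list_of_set.idem_if_sorted_distinct)
    then have "chi ?S = w" by (simp only: chi_def xs(4) t(2))
    ultimately show "w \<in> chi ` {S \<in> copies c A lt col. S \<subseteq> Q}" by blast
  qed
  moreover have "finite (chi ` {S \<in> copies c A lt col. S \<subseteq> Q})"
    by (rule finite_subset[of _ "{..<Suc k}"]) (use chik in auto)
  ultimately have "card (to_nat ` (alternating_on {..<?N} :: nat list set)) \<le> L"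
    using Q(2) card_mono order_trans by metis
  then show ?thesis by (simp add: card_image m_def)
qed

theorem theorem3:
  fixes n :: nat and c :: "rat \<Rightarrow> nat"
    and A :: "'a set" and lt :: "'a \<Rightarrow> 'a \<Rightarrow> bool" and col :: "'a \<Rightarrow> nat"
  assumes "n > 0"
    and "dense_colouring n c"
    and "in_P n A lt col"
    and "A \<noteq> {}"
  shows "least_elem (real ` {L. big_ramsey_bound c A lt col L})
                 ((deriv ^^ (2 * card A - 1)) (tan :: real \<Rightarrow> real) 0)"
proof -
  let ?N = "2 * card A - 1"
  have "real (card (alternating_on {..<?N})) = tangent ?N"
    using card_alternating_on[of "{..<?N}"] by simp
  then have eq: "(deriv ^^ ?N) (tan :: real \<Rightarrow> real) 0 = real (card (alternating_on {..<?N}))"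
    by (simp only: tangent_def)
  show ?thesis
    unfolding least_elem_def eq
    using big_ramsey_upper_bound[OF assms(2-4)] big_ramsey_lower_bound[OF assms(2,3)] by auto
qed

end
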